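(* Let $X$ be a centered (i.e. $\mathbb{E}X=0$) random vector with values in $[-1,1]^n$, satisfying the convex concentration property with constant $K$, and let $A=(a_{ij})_{i,j\le n}$ be a (real) symmetric nonnegative definite matrix. Then there exists a constant $C_K$, depending only on $K$, such that for any $p\ge0$, $$\mathbb{P}\Big(\langle AX,X\rangle-\mathbb{E}\langle AX,X\rangle\ge C_K\big(\|A\|_{\{1,2\},p}+\|A\|_{\{1\}\{2\},p}\big)\Big)\le4e^{-p}$$ and $$\mathbb{P}\Big(\langle AX,X\rangle-\mathbb{E}\langle AX,X\rangle\le-C_K\min\big(\|A\|_{\{1,2\},p}+\|A\|_{\{1\}\{2\},p},\ \sqrt p\,\|A\|_{\{1,2\}}\big)\Big)\le4e^{-p}.$$
   Context: A random vector $X$ in $\mathbb{R}^n$ has the convex concentration property with constant $K$ if for any $L$-Lipschitz (with respect to the Euclidean norm) convex function $f\colon\mathbb{R}^n\to\mathbb{R}$ and any $t>0$, $$\mathbb{P}(|f(X)-\mathrm{Med}\,f(X)|\ge t)\le2\exp\big(-t^2/(K^2L^2)\big),$$ where $\mathrm{Med}$ denotes the median. Let $|\cdot|$ be the Euclidean norm, $|\cdot|_\infty$ the maximum norm and $\langle\cdot,\cdot\rangle$ the standard inner product on $\mathbb{R}^n$. For $x\in\mathbb{R}^n$ and $p\ge0$, $$\|x\|_{\{1\},p}=\sup\Big\{\sum_{i=1}^nx_iy_i\colon\ |y|\le\sqrt p,\ |y|_\infty\le1\Big\}.$$ For a symmetric matrix $A=(a_{ij})_{i,j\le n}$ and $p\ge0$,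 $$\|A\|_{\{1,2\},p}=\|(A_i)_{i\le n}\|_{\{1\},p}\quad\text{with }A_i=\Big(\sum_{j=1}^na_{ij}^2\Big)^{1/2},$$ $$\|A\|_{\{1\}\{2\},p}=\sup\Big\{\sum_{i,j=1}^na_{ij}x_iy_j\colon\ |x|,|y|\le\sqrt p,\ |x|_\infty,|y|_\infty\le1\Big\},$$ and $\|A\|_{\{1,2\}}=\big(\sum_{i,j\le n}a_{ij}^2\big)^{1/2}$ is the Hilbert–Schmidt norm.
   Formalization: The matrix A is assumed nonzero: for A = 0 both events have probability 1, so the claim fails once p > ln 4. The random vector lives on a probability space over real sequences; every law on R^n occurs there and the claim depends only on the law. *)

theory Defs
  imports "HOL-Probability.Probability"
begin

text \<open>
  The constants in the theorem must not depend on the dimension, so \<open>n\<close> has to be quantified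
  inside the formula and cannot be a type.  A vector in \<open>\<real>\<^sup>n\<close> is a function \<open>nat \<Rightarrow> real\<close> and an
  \<open>n \<times> n\<close> matrix a function \<open>nat \<Rightarrow> nat \<Rightarrow> real\<close>, of which only the values at indices \<open>< n\<close>
  matter.  The Euclidean norm of \<open>x\<close> is \<open>L2_set x {..<n}\<close>.
\<close>

definition inner_n :: "nat \<Rightarrow> (nat \<Rightarrow> real) \<Rightarrow> (nat \<Rightarrow> real) \<Rightarrow> real" where
  "inner_n n x y = (\<Sum>i<n. x i * y i)"

text \<open>Only meaningful for \<open>n \<ge> 1\<close>.\<close>

definition max_norm :: "nat \<Rightarrow> (nat \<Rightarrow> real) \<Rightarrow> real" where
  "max_norm n x = (MAX i\<in>{..<n}. \<bar>x i\<bar>)"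

definition mat_vec :: "nat \<Rightarrow> (nat \<Rightarrow> nat \<Rightarrow> real) \<Rightarrow> (nat \<Rightarrow> real) \<Rightarrow> nat \<Rightarrow> real" where
  "mat_vec n A x = (\<lambda>i. \<Sum>j<n. A i j * x j)"

definition symmetric_n :: "nat \<Rightarrow> (nat \<Rightarrow> nat \<Rightarrow> real) \<Rightarrow> bool" where
  "symmetric_n n A \<longleftrightarrow> (\<forall>i<n. \<forall>j<n. A i j = A j i)"

definition nonneg_definite_n :: "nat \<Rightarrow> (nat \<Rightarrow> nat \<Rightarrow> real) \<Rightarrow> bool" where
  "nonneg_definite_n n A \<longleftrightarrow> (\<forall>x. 0 \<le> inner_n n (mat_vec n A x) x)"

definition norm_1 :: "nat \<Rightarrow> real \<Rightarrow> (nat \<Rightarrow> real) \<Rightarrow> real" where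
  "norm_1 n p x =
     Sup {(\<Sum>i<n. x i * y i) | y. L2_set y {..<n} \<le> sqrt p \<and> max_norm n y \<le> 1}"

text \<open>
  In the names below, \<open>12\<close> stands for the one-block partition \<open>{1,2}\<close> and \<open>1_2\<close> for the
  partition \<open>{1}{2}\<close>.
\<close>

definition norm_12 :: "nat \<Rightarrow> real \<Rightarrow> (nat \<Rightarrow> nat \<Rightarrow> real) \<Rightarrow> real" where
  "norm_12 n p A = norm_1 n p (\<lambda>i. sqrt (\<Sum>j<n. (A i j)\<^sup>2))"

definition norm_1_2 :: "nat \<Rightarrow> real \<Rightarrow> (nat \<Rightarrow> nat \<Rightarrow> real) \<Rightarrow> real" where
  "norm_1_2 n p A =
     Sup {(\<Sum>i<n. \<Sum>j<n. A i j * x i * y j) | x y.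
            L2_set x {..<n} \<le> sqrt p \<and> L2_set y {..<n} \<le> sqrt p \<and>
            max_norm n x \<le> 1 \<and> max_norm n y \<le> 1}"

definition hs_norm :: "nat \<Rightarrow> (nat \<Rightarrow> nat \<Rightarrow> real) \<Rightarrow> real" where
  "hs_norm n A = sqrt (\<Sum>i<n. \<Sum>j<n. (A i j)\<^sup>2)"

text \<open>
  The type \<open>nat \<Rightarrow> real\<close> is no instance of \<open>real_vector\<close>, and its \<open>metric_space\<close> instance is not
  the Euclidean distance, so \<open>convex_on\<close> and \<open>lipschitz_on\<close> are not applicable.  A function
  satisfying \<open>lipschitz_n\<close> depends only on the coordinates \<open>< n\<close>, hence is a function
  on \<open>\<real>\<^sup>n\<close>.
\<close>

definition lipschitz_n :: "nat \<Rightarrow> real \<Rightarrow> ((nat \<Rightarrow> real) \<Rightarrow> real) \<Rightarrow> bool" where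
  "lipschitz_n n L f \<longleftrightarrow> (\<forall>x y. \<bar>f x - f y\<bar> \<le> L * L2_set (\<lambda>i. x i - y i) {..<n})"

definition convex_fun :: "((nat \<Rightarrow> real) \<Rightarrow> real) \<Rightarrow> bool" where
  "convex_fun f \<longleftrightarrow>
     (\<forall>x y. \<forall>t\<in>{0..1}. f (\<lambda>i. (1 - t) * x i + t * y i) \<le> (1 - t) * f x + t * f y)"

definition random_vector :: "'a measure \<Rightarrow> nat \<Rightarrow> ('a \<Rightarrow> nat \<Rightarrow> real) \<Rightarrow> bool" where
  "random_vector M n X \<longleftrightarrow> (\<forall>i<n. (\<lambda>\<omega>. X \<omega> i) \<in> borel_measurable M)"

definition is_median :: "'a measure \<Rightarrow> ('a \<Rightarrow> real) \<Rightarrow> real \<Rightarrow> bool" where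
  "is_median M Y m \<longleftrightarrow> \<P>(\<omega> in M. Y \<omega> \<le> m) \<ge> 1/2 \<and> \<P>(\<omega> in M. Y \<omega> \<ge> m) \<ge> 1/2"

text \<open>
  A median need not be unique.  The property is required for some median of \<open>f(X)\<close>, which is
  implied by the property for any fixed choice of medians.
\<close>

definition convex_concentration ::
    "'a measure \<Rightarrow> nat \<Rightarrow> ('a \<Rightarrow> nat \<Rightarrow> real) \<Rightarrow> real \<Rightarrow> bool" where
  "convex_concentration M n X K \<longleftrightarrow>
     (\<forall>f L. 0 < L \<longrightarrow> lipschitz_n n L f \<longrightarrow> convex_fun f \<longrightarrow>
        (\<exists>m. is_median M (\<lambda>\<omega>. f (X \<omega>)) m \<and>
           (\<forall>t>0. \<P>(\<omega> in M. \<bar>f (X \<omega>) - m\<bar> \<ge> t) \<le> 2 * exp (- t\<^sup>2 / (K\<^sup>2 * L\<^sup>2)))))"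

definition quad_form :: "nat \<Rightarrow> (nat \<Rightarrow> nat \<Rightarrow> real) \<Rightarrow> (nat \<Rightarrow> real) \<Rightarrow> real" where
  "quad_form n A x = inner_n n (mat_vec n A x) x"

text \<open>
  The hypotheses on \<open>X\<close>.  In the theorem the sample space has type \<open>nat \<Rightarrow> real\<close>, because a
  constant chosen after a type variable could depend on it.  This is no restriction on the
  law: every law on \<open>\<real>\<^sup>n\<close> occurs on this type, with \<open>X\<close> the identity.
\<close>

definition centered_bounded_vector :: "'a measure \<Rightarrow> nat \<Rightarrow> ('a \<Rightarrow> nat \<Rightarrow> real) \<Rightarrow> bool" where
  "centered_bounded_vector M n X \<longleftrightarrow>
     random_vector M n X \<and>
     (\<forall>\<omega>\<in>space M. \<forall>i<n. X \<omega> i \<in> {-1..1}) \<and>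
     (\<forall>i<n. (\<integral>\<omega>. X \<omega> i \<partial>M) = 0)"

end

theory Submission
  imports Defs
begin

text \<open>
  Write \<open>q\<close> for the quadratic form, \<open>m\<close> for a median of \<open>q(X)\<close> and \<open>T\<close> for the set of test vectors
  \<open>\<bar>y\<bar> \<le> sqrt p\<close>, \<open>\<bar>y\<bar>\<^sub>\<infinity> \<le> 1\<close>.  Convex concentration, applied to the distance from a convex set \<open>D\<close> of
  not too small probability, shows that outside an event of probability \<open>2 exp (- p)\<close> the vector
  \<open>X\<close> lies within \<open>O(sqrt p)\<close> of some \<open>d\<close> in \<open>D\<close>; if moreover \<open>D\<close> lies in the cube, then \<open>X - d\<close> is a
  constant multiple of a point of \<open>T\<close>.  The gradient term of \<open>q(X) = q(d) + 2 \<langle>A d, X - d\<rangle> + q(X - d)\<close>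
  is controlled by a convex function \<open>g\<close> that dominates the supremum of \<open>\<langle>A x, y\<rangle>\<close> over \<open>T\<close> and whose
  mean at \<open>X\<close> is of order \<open>norm_12 n p A\<close>, and the last term by \<open>norm_1_2 n p A\<close>.  The upper tail follows
  with \<open>D = {q \<le> m, g \<lesssim> norm_12}\<close>, the lower tail by expanding around \<open>X\<close> with \<open>D = {q \<le> m - s}\<close>.
  Integrating these tails bounds the distance of the mean from \<open>m\<close> by the Hilbert-Schmidt norm,
  which is at most \<open>norm_12 n p A\<close> for \<open>p \<ge> 1\<close>.  For \<open>p < 1\<close> the claimed bound exceeds \<open>1\<close>.
\<close>

section \<open>Measurability of Lipschitz functions of the random vector\<close>

text \<open>Continuity refers to the product topology on \<open>nat \<Rightarrow> real\<close>. The
  Lipschitz bound involves finitely many coordinates, each continuous in that topology, so it tends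
  to zero.\<close>

lemma lipschitz_n_continuous:
  assumes "lipschitz_n n L f"
  shows "continuous_on UNIV f"
proof -
  have "(f \<longlongrightarrow> f x) (at x)" for x
  proof -
    have coord: "((\<lambda>y. y i) \<longlongrightarrow> x i) (at x)" for i
    proof -
      have "continuous_on UNIV (\<lambda>y :: nat \<Rightarrow> real. y i)"
        by (rule continuous_on_product_coordinates)
      then show ?thesis
        by (simp add: continuous_on_def)
    qed
    have "((\<lambda>y. L * L2_set (\<lambda>i. y i - x i) {..<n}) \<longlongrightarrow> L * L2_set (\<lambda>i. x i - x i) {..<n}) (at x)"
      unfolding L2_set_def
      by (intro tendsto_intros coord)
    then have "((\<lambda>y. L * L2_set (\<lambda>i. y i - x i) {..<n}) \<longlongrightarrow> 0) (at x)"
      by (simp add: L2_set_def)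
    then have "((\<lambda>y. f y - f x) \<longlongrightarrow> 0) (at x)"
      by (rule Lim_null_comparison[rotated]) (use assms in \<open>simp add: lipschitz_n_def\<close>)
    then show ?thesis
      by (simp add: LIM_zero_iff)
  qed
  then show ?thesis
    by (simp add: continuous_on_def)
qed

lemma lipschitz_n_measurable:
  assumes "random_vector M n X" "lipschitz_n n L f"
  shows "(\<lambda>\<omega>. f (X \<omega>)) \<in> borel_measurable M"
proof -
  \<comment> \<open>Nothing is assumed about the coordinates of \<open>X\<close> from
    \<open>n\<close> on. Setting them to zero makes the vector measurable and leaves
    \<open>f (X \<omega>)\<close> unchanged, because the Lipschitz bound does not see them.\<close>
  define Y where "Y \<omega> i = (if i < n then X \<omega> i else 0)" for \<omega> i
  have "\<bar>f (X \<omega>) - f (Y \<omega>)\<bar> \<le> L * L2_set (\<lambda>i. X \<omega> i - Y \<omega> i) {..<n}" for \<omega>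
    using assms(2) by (simp add: lipschitz_n_def)
  then have "f (X \<omega>) = f (Y \<omega>)" for \<omega>
    by (simp add: Y_def L2_set_def)
  moreover have "Y \<in> borel_measurable M"
  proof (rule measurable_coordinatewise_then_product)
    show "(\<lambda>\<omega>. Y \<omega> i) \<in> borel_measurable M" for i
      using assms(1) by (cases "i < n") (simp_all add: Y_def random_vector_def)
  qed
  moreover have "f \<in> borel_measurable borel"
    using lipschitz_n_continuous[OF assms(2)] by (rule borel_measurable_continuous_onI)
  ultimately show ?thesis
    by (simp add: measurable_compose)
qed

section \<open>Distance to a convex set\<close>

definition convex_set_n :: "(nat \<Rightarrow> real) set \<Rightarrow> bool" where
  "convex_set_n D \<longleftrightarrow> (\<forall>x\<in>D. \<forall>y\<in>D. \<forall>t\<in>{0..1}. (\<lambda>i. (1 - t) * x i + t * y i) \<in> D)"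

definition dist_n :: "nat \<Rightarrow> (nat \<Rightarrow> real) set \<Rightarrow> (nat \<Rightarrow> real) \<Rightarrow> real" where
  "dist_n n D x = (INF d\<in>D. L2_set (\<lambda>i. x i - d i) {..<n})"

lemma dist_n_bdd_below: "bdd_below ((\<lambda>d. L2_set (\<lambda>i. x i - d i) {..<n}) ` D)"
  by (intro bdd_belowI2[of _ 0]) (rule L2_set_nonneg)

lemma dist_n_le: "d \<in> D \<Longrightarrow> dist_n n D x \<le> L2_set (\<lambda>i. x i - d i) {..<n}"
  unfolding dist_n_def by (rule cINF_lower[OF dist_n_bdd_below])

lemma dist_n_nonneg: "D \<noteq> {} \<Longrightarrow> 0 \<le> dist_n n D x"
  unfolding dist_n_def by (intro cINF_greatest L2_set_nonneg)

text \<open>The infimum need not be attained, so nearby points of \<open>D\<close> are always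
  extracted from a strict inequality.\<close>

lemma dist_n_less:
  assumes "D \<noteq> {}" "dist_n n D x < r"
  obtains d where "d \<in> D" "L2_set (\<lambda>i. x i - d i) {..<n} < r"
  using assms cINF_less_iff[OF assms(1) dist_n_bdd_below] unfolding dist_n_def by metis

lemma dist_n_member: "x \<in> D \<Longrightarrow> dist_n n D x = 0"
  using dist_n_le[of x D n x] dist_n_nonneg[of D n x] by (force simp: L2_set_def)

lemma L2_set_scale: "0 \<le> c \<Longrightarrow> L2_set (\<lambda>i. c * x i) S = c * L2_set x S"
  by (simp add: L2_set_right_distrib)

lemma L2_set_abs: "L2_set (\<lambda>i. \<bar>x i\<bar>) S = L2_set x S"
  by (simp add: L2_set_def)

lemma lipschitz_dist_n:
  assumes "D \<noteq> {}"
  shows "lipschitz_n n 1 (dist_n n D)"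
proof -
  have le: "dist_n n D x - dist_n n D y \<le> L2_set (\<lambda>i. x i - y i) {..<n}" for x y
  proof -
    have "dist_n n D x - L2_set (\<lambda>i. x i - y i) {..<n} \<le> dist_n n D y"
      unfolding dist_n_def[of n D y]
    proof (rule cINF_greatest[OF assms])
      fix d assume "d \<in> D"
      have "dist_n n D x \<le> L2_set (\<lambda>i. (x i - y i) + (y i - d i)) {..<n}"
        using dist_n_le[OF \<open>d \<in> D\<close>, of n x] by simp
      also have "\<dots> \<le> L2_set (\<lambda>i. x i - y i) {..<n} + L2_set (\<lambda>i. y i - d i) {..<n}"
        by (rule L2_set_triangle_ineq)
      finally show "dist_n n D x - L2_set (\<lambda>i. x i - y i) {..<n} \<le> L2_set (\<lambda>i. y i - d i) {..<n}"
        by simp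
    qed
    then show ?thesis by simp
  qed
  have "L2_set (\<lambda>i. x i - y i) {..<n} = L2_set (\<lambda>i. y i - x i) {..<n}" for x y :: "nat \<Rightarrow> real"
    by (simp add: L2_set_def power2_commute)
  then show ?thesis
    unfolding lipschitz_n_def using le by (simp add: abs_le_iff) (metis minus_diff_eq)
qed

lemma convex_dist_n:
  assumes "D \<noteq> {}" "convex_set_n D"
  shows "convex_fun (dist_n n D)"
  unfolding convex_fun_def
proof (intro allI ballI)
  fix x y :: "nat \<Rightarrow> real" and t :: real
  assume t: "t \<in> {0..1}"
  show "dist_n n D (\<lambda>i. (1 - t) * x i + t * y i) \<le> (1 - t) * dist_n n D x + t * dist_n n D y"
  proof (rule field_le_epsilon)
    fix e :: real assume "e > 0"
    \<comment> \<open>Near-minimisers for \<open>x\<close> and \<open>y\<close>, mixed with the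
      weights \<open>1 - t\<close> and \<open>t\<close>, form a competitor in \<open>D\<close> for
      the mixed point.\<close>
    obtain a where a: "a \<in> D" "L2_set (\<lambda>i. x i - a i) {..<n} < dist_n n D x + e"
      using dist_n_less[OF assms(1), of n x "dist_n n D x + e"] \<open>e > 0\<close> by auto
    obtain b where b: "b \<in> D" "L2_set (\<lambda>i. y i - b i) {..<n} < dist_n n D y + e"
      using dist_n_less[OF assms(1), of n y "dist_n n D y + e"] \<open>e > 0\<close> by auto
    have "(\<lambda>i. (1 - t) * a i + t * b i) \<in> D"
      using assms(2) a b t by (auto simp: convex_set_n_def)
    from dist_n_le[OF this, of n "\<lambda>i. (1 - t) * x i + t * y i"]
    have "dist_n n D (\<lambda>i. (1 - t) * x i + t * y i)
      \<le> L2_set (\<lambda>i. (1 - t) * (x i - a i) + t * (y i - b i)) {..<n}"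
      by (simp add: algebra_simps)
    also have "\<dots> \<le> (1 - t) * L2_set (\<lambda>i. x i - a i) {..<n} + t * L2_set (\<lambda>i. y i - b i) {..<n}"
      using L2_set_triangle_ineq[of "\<lambda>i. (1 - t) * (x i - a i)" "\<lambda>i. t * (y i - b i)" "{..<n}"] t
      by (simp add: L2_set_scale)
    also have "\<dots> \<le> (1 - t) * (dist_n n D x + e) + t * (dist_n n D y + e)"
      using a b t by (intro add_mono mult_left_mono) auto
    finally show "dist_n n D (\<lambda>i. (1 - t) * x i + t * y i)
        \<le> (1 - t) * dist_n n D x + t * dist_n n D y + e"
      by (simp add: algebra_simps)
  qed
qed

section \<open>Integration of tails and existence of medians\<close>

context prob_space
begin

text \<open>A discrete layer-cake argument: \<open>Y / b\<close> is at most the number of levels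
  \<open>b * real k\<close> that \<open>Y\<close> reaches, and the probabilities of reaching them
  are summed.\<close>

lemma expectation_le_exponential_tail:
  fixes Y :: "'a \<Rightarrow> real"
  assumes [measurable]: "Y \<in> borel_measurable M"
    and bdd: "\<And>\<omega>. \<omega> \<in> space M \<Longrightarrow> Y \<omega> \<le> B" and nonneg: "\<And>\<omega>. \<omega> \<in> space M \<Longrightarrow> 0 \<le> Y \<omega>"
    and "b > 0" and tail: "\<And>k::nat. \<P>(\<omega> in M. Y \<omega> \<ge> b * real k) \<le> c * exp (- real k)"
  shows "expectation Y \<le> 2 * c * b"
proof -
  have "c \<ge> 0"
    using order_trans[OF measure_nonneg tail[of 0]] by simp
  \<comment> \<open>The upper bound \<open>B\<close> leaves only finitely many levels to
    count.\<close>
  define N where "N = nat \<lceil>B / b\<rceil> + 1"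
  define Z where "Z \<omega> = b * (\<Sum>k<N. indicator {\<omega> \<in> space M. Y \<omega> \<ge> b * real k} \<omega>)" for \<omega>
  have YZ: "Y \<omega> \<le> Z \<omega>" if "\<omega> \<in> space M" for \<omega>
  proof -
    \<comment> \<open>The extra 1 accounts for level \<open>k = 0\<close>, which is always
      reached.\<close>
    define j where "j = nat \<lfloor>Y \<omega> / b\<rfloor> + 1"
    have Yb: "0 \<le> Y \<omega> / b" "Y \<omega> / b \<le> B / b"
      using nonneg[OF that] bdd[OF that] \<open>b > 0\<close> by (auto simp: divide_right_mono)
    have "j \<le> N"
      using Yb unfolding j_def N_def by (simp add: nat_mono) linarith
    have "Y \<omega> / b \<le> real j"
      using Yb(1) unfolding j_def by linarith
    also have "real j = (\<Sum>k<j. indicator {\<omega> \<in> space M. Y \<omega> \<ge> b * real k} \<omega>)"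
    proof -
      have "b * real k \<le> Y \<omega>" if "k < j" for k
      proof -
        have "real k \<le> Y \<omega> / b"
          using that Yb(1) unfolding j_def by linarith
        then show ?thesis using \<open>b > 0\<close> by (simp add: field_simps)
      qed
      then show ?thesis using that by simp
    qed
    also have "\<dots> \<le> (\<Sum>k<N. indicator {\<omega> \<in> space M. Y \<omega> \<ge> b * real k} \<omega>)"
      using \<open>j \<le> N\<close> by (intro sum_mono2) auto
    finally show ?thesis
      using \<open>b > 0\<close> unfolding Z_def by (simp add: field_simps)
  qed
  have "expectation Y \<le> expectation Z"
  proof (rule integral_mono)
    show "integrable M Y"
      using bdd nonneg by (intro integrable_const_bound[of _ B]) auto
    show "integrable M Z"
      unfolding Z_def by (intro integrable_mult_right integrable_sum) (auto simp: integrable_indicator_iff less_top[symmetric])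
  qed (rule YZ)
  also have "expectation Z = b * (\<Sum>k<N. \<P>(\<omega> in M. Y \<omega> \<ge> b * real k))"
    unfolding Z_def by (subst integral_mult_right_zero, subst Bochner_Integration.integral_sum)
      (auto simp: integrable_indicator_iff less_top[symmetric] Int_def conj_commute cong: conj_cong)
  \<comment> \<open>Replacing \<open>exp (- real k)\<close> by \<open>(1/2) ^ k\<close> gives a
    geometric series with sum below 2, the source of the factor 2 in the claim.\<close>
  also have "\<dots> \<le> b * (\<Sum>k<N. c * (1/2) ^ k)"
  proof (intro mult_left_mono sum_mono)
    fix k :: nat
    have "exp (- 1) \<le> (1/2 :: real)"
      using exp_ge_add_one_self[of 1] by (simp add: exp_minus field_simps)
    then have "exp (- 1) ^ k \<le> (1/2 :: real) ^ k"
      by (intro power_mono) auto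
    then have "exp (- real k) \<le> (1/2) ^ k"
      by (simp flip: exp_of_nat_mult)
    then show "\<P>(\<omega> in M. Y \<omega> \<ge> b * real k) \<le> c * (1/2) ^ k"
      using tail[of k] \<open>c \<ge> 0\<close> by (meson mult_left_mono order_trans)
  qed (use \<open>b > 0\<close> in auto)
  also have "\<dots> = b * c * (2 - 2 * (1/2) ^ N)"
    by (simp add: sum_distrib_left[symmetric] sum_gp_strict)
  also have "\<dots> \<le> b * c * 2"
    using \<open>b > 0\<close> \<open>c \<ge> 0\<close> by (intro mult_left_mono) auto
  finally show ?thesis by (simp add: mult_ac)
qed

lemma expectation_le_sqrt_second_moment:
  fixes Y :: "'a \<Rightarrow> real"
  assumes "integrable M Y" "integrable M (\<lambda>\<omega>. (Y \<omega>)\<^sup>2)"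
  shows "expectation Y \<le> sqrt (expectation (\<lambda>\<omega>. (Y \<omega>)\<^sup>2))"
  using variance_eq[OF assms] variance_positive[of Y] by (intro real_le_rsqrt) simp

text \<open>The point where the distribution function first reaches 1/2 works: right continuity
  gives one inequality, the left limit the other. This is needed for the quadratic form, which is
  not globally Lipschitz, so that convex concentration supplies no median for it.\<close>

lemma median_exists:
  assumes [measurable]: "Y \<in> borel_measurable M"
  shows "\<exists>m. is_median M Y m"
proof -
  interpret D: real_distribution "distr M borel Y"
    by (rule real_distribution_distr) simp
  let ?F = "cdf (distr M borel Y)"
  have F: "?F t = \<P>(\<omega> in M. Y \<omega> \<le> t)" for t
    by (simp add: cdf_def measure_distr vimage_def Int_def conj_commute)
  define S where "S = {t. ?F t \<ge> 1/2}"
  have "eventually (\<lambda>t. ?F t > 1/2) at_top"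
    using D.cdf_lim_at_top_prob by (rule order_tendstoD) simp
  then obtain t1 where "?F t1 > 1/2"
    by (auto simp: eventually_at_top_linorder)
  then have "S \<noteq> {}" unfolding S_def by (auto intro: less_imp_le)
  have "eventually (\<lambda>t. ?F t < 1/2) at_bot"
    using D.cdf_lim_at_bot by (rule order_tendstoD) simp
  then obtain t0 where t0: "\<And>t. t \<le> t0 \<Longrightarrow> ?F t < 1/2"
    by (auto simp: eventually_at_bot_linorder)
  have "bdd_below S"
    by (rule bdd_belowI[of _ t0]) (metis S_def linorder_linear mem_Collect_eq not_less t0)
  define m where "m = Inf S"
  have above: "?F t \<ge> 1/2" if t: "t > m" for t
  proof -
    obtain s where "s \<in> S" "s < t"
      using t cInf_less_iff[OF \<open>S \<noteq> {}\<close> \<open>bdd_below S\<close>, of t] unfolding m_def by auto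
    then show ?thesis
      using D.cdf_nondecreasing[of s t] by (simp add: S_def)
  qed
  have "?F m \<ge> 1/2"
  proof (rule tendsto_lowerbound)
    show "(?F \<longlongrightarrow> ?F m) (at_right m)"
      using D.cdf_is_right_cont[of m] by (simp add: continuous_within)
    show "eventually (\<lambda>t. 1/2 \<le> ?F t) (at_right m)"
      using above by (auto simp: eventually_at_filter)
  qed simp
  moreover have "\<P>(\<omega> in M. Y \<omega> < m) \<le> 1/2"
  proof -
    have "measure (distr M borel Y) {..<m} \<le> 1/2"
    proof (rule tendsto_upperbound)
      show "(?F \<longlongrightarrow> measure (distr M borel Y) {..<m}) (at_left m)"
        by (rule D.cdf_at_left)
      have "?F t \<le> 1/2" if "t < m" for t
        using that cInf_lower[OF _ \<open>bdd_below S\<close>, of t] unfolding m_def S_def by force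
      then show "eventually (\<lambda>t. ?F t \<le> 1/2) (at_left m)"
        by (auto simp: eventually_at_filter)
    qed simp
    then show ?thesis
      by (simp add: measure_distr vimage_def Int_def conj_commute)
  qed
  moreover have "\<P>(\<omega> in M. Y \<omega> \<ge> m) = 1 - \<P>(\<omega> in M. Y \<omega> < m)"
    by (subst prob_neg[symmetric]) (auto simp: not_less)
  ultimately show ?thesis
    unfolding is_median_def F by (intro exI[of _ m]) auto
qed

end

section \<open>The vector norm \<open>norm_1\<close> and its test vectors\<close>

lemma max_norm_le_iff:
  assumes "n \<ge> 1"
  shows "max_norm n y \<le> c \<longleftrightarrow> (\<forall>i<n. \<bar>y i\<bar> \<le> c)"
proof -
  have "{..<n} \<noteq> {}"
    using assms by (auto simp: lessThan_empty_iff)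
  then show ?thesis
    unfolding max_norm_def by (subst Max_le_iff) auto
qed

definition test_set :: "nat \<Rightarrow> real \<Rightarrow> (nat \<Rightarrow> real) set" where
  "test_set n p = {y. L2_set y {..<n} \<le> sqrt p \<and> (\<forall>i<n. \<bar>y i\<bar> \<le> 1)}"

lemma norm_1_eq: "n \<ge> 1 \<Longrightarrow> norm_1 n p x = (SUP y\<in>test_set n p. inner_n n x y)"
  by (simp add: norm_1_def test_set_def inner_n_def max_norm_le_iff image_Collect)

lemma inner_n_le_L2: "\<bar>inner_n n x y\<bar> \<le> L2_set x {..<n} * L2_set y {..<n}"
proof -
  have "\<bar>inner_n n x y\<bar> \<le> (\<Sum>i<n. \<bar>x i\<bar> * \<bar>y i\<bar>)"
    unfolding inner_n_def by (rule order_trans[OF sum_abs]) (simp add: abs_mult)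
  also have "\<dots> \<le> L2_set x {..<n} * L2_set y {..<n}"
    by (rule L2_set_mult_ineq)
  finally show ?thesis .
qed

lemma inner_n_test_set_le:
  assumes "y \<in> test_set n p"
  shows "inner_n n x y \<le> sqrt p * L2_set x {..<n}"
proof -
  have "inner_n n x y \<le> L2_set x {..<n} * L2_set y {..<n}"
    using inner_n_le_L2[of n x y] by linarith
  also have "\<dots> \<le> L2_set x {..<n} * sqrt p"
    using assms by (intro mult_left_mono) (auto simp: test_set_def)
  finally show ?thesis by (simp add: mult.commute)
qed

lemma zero_in_test_set: "p \<ge> 0 \<Longrightarrow> (\<lambda>_. 0) \<in> test_set n p"
  by (simp add: test_set_def L2_set_def)

lemma norm_1_upper:
  assumes "n \<ge> 1" "y \<in> test_set n p"
  shows "inner_n n x y \<le> norm_1 n p x"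
  unfolding norm_1_eq[OF assms(1)]
  by (rule cSUP_upper[OF assms(2)])
    (auto intro!: bdd_aboveI[of _ "sqrt p * L2_set x {..<n}"] inner_n_test_set_le)

lemma norm_1_le:
  assumes "n \<ge> 1" "p \<ge> 0"
  shows "norm_1 n p x \<le> sqrt p * L2_set x {..<n}"
  unfolding norm_1_eq[OF assms(1)]
  using zero_in_test_set[OF assms(2), of n] by (intro cSUP_least inner_n_test_set_le) auto

text \<open>The normalised vector \<open>x\<close> is itself a test vector: its length 1 is at most
  \<open>sqrt p\<close> because \<open>p \<ge> 1\<close>, and its entries are at most 1.\<close>

lemma L2_le_norm_1:
  assumes "n \<ge> 1" "p \<ge> 1"
  shows "L2_set x {..<n} \<le> norm_1 n p x"
proof (cases "L2_set x {..<n} = 0")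
  case True
  then show ?thesis
    using norm_1_upper[OF assms(1) zero_in_test_set, of p x] assms by (simp add: inner_n_def)
next
  case False
  define r where "r = L2_set x {..<n}"
  have "r > 0"
    using False L2_set_nonneg[of x "{..<n}"] unfolding r_def by linarith
  define y where "y i = (1 / r) * x i" for i
  have "L2_set y {..<n} = 1"
    unfolding y_def using \<open>r > 0\<close> by (subst L2_set_scale) (auto simp: r_def)
  moreover have "\<bar>y i\<bar> \<le> 1" if "i < n" for i
    using member_le_L2_set[of "{..<n}" i "\<lambda>i. \<bar>y i\<bar>"] that calculation by (simp add: L2_set_abs)
  ultimately have "y \<in> test_set n p"
    using assms by (simp add: test_set_def)
  from norm_1_upper[OF assms(1) this, of x] have "inner_n n x y \<le> norm_1 n p x" .
  moreover have "inner_n n x y = r"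
  proof -
    have "inner_n n x y = (\<Sum>i<n. (x i)\<^sup>2) / r"
      unfolding inner_n_def y_def by (simp add: sum_divide_distrib power2_eq_square)
    also have "(\<Sum>i<n. (x i)\<^sup>2) = r\<^sup>2"
      unfolding r_def L2_set_def by (simp add: sum_nonneg)
    finally show ?thesis using \<open>r > 0\<close> by (simp add: power2_eq_square)
  qed
  ultimately show ?thesis by (simp add: r_def)
qed

text \<open>
  The set \<open>I\<close> collects the entries exceeding \<open>norm_1 n p x / \<lfloor>p\<rfloor>\<close>: there are at most \<open>p\<close> of them,
  and on the others the constraint \<open>\<bar>y i\<bar> \<le> 1\<close> costs only a constant factor.
\<close>

lemma norm_1_decomposition:
  assumes "n \<ge> 1" "p \<ge> 1" and nonneg: "\<And>i. 0 \<le> x i"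
  obtains I where "I \<subseteq> {..<n}"
    "sum x I + sqrt p * L2_set x ({..<n} - I) \<le> 3 * norm_1 n p x"
proof -
  define N where "N = norm_1 n p x"
  \<comment> \<open>The integer part of \<open>p\<close> can be compared with cardinalities; the
    price is the factor 2 in \<open>p \<le> 2 * real k\<close>.\<close>
  define k where "k = nat \<lfloor>p\<rfloor>"
  define I where "I = {i. i < n \<and> x i > N / k}"
  have k: "1 \<le> k" "real k \<le> p" "p \<le> 2 * real k"
  proof -
    have k: "real k = of_int \<lfloor>p\<rfloor>"
      using assms(2) by (simp add: k_def)
    have "1 \<le> \<lfloor>p\<rfloor>"
      using assms(2) by simp
    then have "1 \<le> real k"
      unfolding k by simp
    then show "1 \<le> k"
      by simp
    show "real k \<le> p"
      unfolding k by simp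
    show "p \<le> 2 * real k"
      using floor_correct[of p] \<open>1 \<le> real k\<close> unfolding k by linarith
  qed
  have [simp]: "finite I" by (simp add: I_def)
  have "N \<ge> 0"
    using L2_le_norm_1[OF assms(1,2), of x] L2_set_nonneg[of x "{..<n}"] unfolding N_def by linarith
  \<comment> \<open>The indicator of at most \<open>k \<le> p\<close> indices is a test
    vector.\<close>
  have sum_le: "sum x J \<le> N" if J: "J \<subseteq> {..<n}" "card J \<le> k" for J
  proof -
    define y :: "nat \<Rightarrow> real" where "y = indicator J"
    have "(\<Sum>i<n. (y i)\<^sup>2) = real (card J)"
      using J(1) by (simp add: y_def indicator_def power2_eq_square if_distrib Int_absorb1
        sum.If_cases cong: if_cong)
    then have "L2_set y {..<n} \<le> sqrt p"
      using J(2) k unfolding L2_set_def by simp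
    then have "y \<in> test_set n p"
      by (auto simp: test_set_def y_def indicator_def)
    moreover have "inner_n n x y = sum x J"
      using J(1) by (simp add: inner_n_def y_def indicator_def if_distrib Int_absorb1
        sum.If_cases cong: if_cong)
    ultimately show ?thesis
      using norm_1_upper[OF assms(1), of y p x] by (simp add: N_def)
  qed
  have "card I \<le> k"
  proof (rule ccontr)
    assume "\<not> card I \<le> k"
    then have "k \<le> card I" by simp
    \<comment> \<open>Already \<open>k\<close> entries above \<open>N / k\<close> would sum to more
      than \<open>N\<close>.\<close>
    then obtain J where J: "J \<subseteq> I" "card J = k"
      by (rule obtain_subset_with_card_n)
    have "finite J" "J \<noteq> {}"
      using J(2) k(1) finite_subset[OF J(1)] by auto
    have "real (card J) * (N / k) < sum x J"
      using J(1) \<open>finite J\<close> \<open>J \<noteq> {}\<close> sum_strict_mono[of J "\<lambda>_. N / k" x] by (auto simp: I_def)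
    moreover have "sum x J \<le> N"
      using J by (intro sum_le) (auto simp: I_def)
    ultimately show False
      using J(2) k(1) by simp
  qed
  have "sqrt p * L2_set x ({..<n} - I) \<le> 2 * N"
  proof (cases "sqrt p * (N / k) < L2_set x ({..<n} - I)")
    case True
    define r where "r = L2_set x ({..<n} - I)"
    have "0 \<le> sqrt p * (N / k)"
      using \<open>N \<ge> 0\<close> assms(2) by simp
    then have "r > 0" using True by (simp add: r_def)
    \<comment> \<open>The part of \<open>x\<close> off \<open>I\<close>, rescaled to length
      \<open>sqrt p\<close>. The case assumption keeps its entries at most 1, since
      \<open>x i \<le> N / k\<close> off \<open>I\<close>.\<close>
    define y where "y i = (if i \<in> I then 0 else sqrt p / r * x i)" for i
    have "L2_set y {..<n} = L2_set (\<lambda>i. sqrt p / r * x i) ({..<n} - I)"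
      unfolding L2_set_def y_def by (rule arg_cong[of _ _ sqrt]) (rule sum.mono_neutral_cong_right, auto)
    also have "\<dots> = sqrt p"
      using \<open>r > 0\<close> assms(2) by (subst L2_set_scale) (auto simp: r_def)
    finally have "L2_set y {..<n} \<le> sqrt p" by simp
    moreover have "\<bar>y i\<bar> \<le> 1" if "i < n" for i
    proof (cases "i \<in> I")
      case False
      then have "x i \<le> N / k" using that by (auto simp: I_def)
      then have "sqrt p * x i \<le> sqrt p * (N / k)"
        using assms(2) by (intro mult_left_mono) auto
      also have "\<dots> \<le> r" using True by (simp add: r_def)
      finally show ?thesis
        using False \<open>r > 0\<close> nonneg[of i] assms(2) by (simp add: y_def abs_mult field_simps)
    qed (simp add: y_def)
    ultimately have "y \<in> test_set n p" by (simp add: test_set_def)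
    then have "inner_n n x y \<le> N"
      unfolding N_def by (rule norm_1_upper[OF assms(1)])
    moreover have "inner_n n x y = sqrt p * r"
    proof -
      have "inner_n n x y = (\<Sum>i\<in>{..<n} - I. sqrt p / r * (x i)\<^sup>2)"
        unfolding inner_n_def y_def
        by (rule sum.mono_neutral_cong_right) (auto simp: power2_eq_square)
      also have "\<dots> = sqrt p / r * r\<^sup>2"
        unfolding r_def L2_set_def by (simp add: sum_nonneg sum_distrib_left)
      finally show ?thesis using \<open>r > 0\<close> by (simp add: power2_eq_square)
    qed
    ultimately show ?thesis using \<open>N \<ge> 0\<close> by (simp add: r_def)
  next
    case False
    then have "sqrt p * L2_set x ({..<n} - I) \<le> sqrt p * (sqrt p * (N / k))"
      using assms(2) by (intro mult_left_mono) auto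
    also have "\<dots> = p / k * N"
      using assms(2) by simp
    also have "\<dots> \<le> 2 * N"
      using k \<open>N \<ge> 0\<close> by (intro mult_right_mono) (auto simp: field_simps)
    finally show ?thesis .
  qed
  moreover have "I \<subseteq> {..<n}" by (auto simp: I_def)
  ultimately show ?thesis
    using that[of I] sum_le[of I] \<open>card I \<le> k\<close> by (simp add: N_def)
qed

section \<open>Algebra and convexity of the quadratic form\<close>

lemma mat_vec_add: "mat_vec n A (\<lambda>j. x j + y j) i = mat_vec n A x i + mat_vec n A y i"
  by (simp add: mat_vec_def algebra_simps sum.distrib)

lemma mat_vec_scale: "mat_vec n A (\<lambda>j. c * x j) i = c * mat_vec n A x i"
  by (simp add: mat_vec_def sum_distrib_left mult.left_commute)

lemma inner_n_add_left: "inner_n n (\<lambda>i. x i + y i) z = inner_n n x z + inner_n n y z"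
  by (simp add: inner_n_def algebra_simps sum.distrib)

lemma inner_n_add_right: "inner_n n z (\<lambda>i. x i + y i) = inner_n n z x + inner_n n z y"
  by (simp add: inner_n_def algebra_simps sum.distrib)

lemma inner_n_scale_left: "inner_n n (\<lambda>i. c * x i) y = c * inner_n n x y"
  by (simp add: inner_n_def sum_distrib_left mult.assoc)

lemma inner_n_scale_right: "inner_n n x (\<lambda>i. c * y i) = c * inner_n n x y"
  by (simp add: inner_n_def sum_distrib_left mult.left_commute)

lemma inner_mat_vec_sym:
  assumes "symmetric_n n A"
  shows "inner_n n (mat_vec n A x) y = inner_n n (mat_vec n A y) x"
proof -
  have "inner_n n (mat_vec n A x) y = (\<Sum>i<n. \<Sum>j<n. A i j * x j * y i)"
    by (simp add: inner_n_def mat_vec_def sum_distrib_right)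
  also have "\<dots> = (\<Sum>j<n. \<Sum>i<n. A i j * x j * y i)"
    by (rule sum.swap)
  also have "\<dots> = (\<Sum>j<n. \<Sum>i<n. A j i * y i * x j)"
    using assms by (intro sum.cong) (auto simp: symmetric_n_def)
  also have "\<dots> = inner_n n (mat_vec n A y) x"
    by (simp add: inner_n_def mat_vec_def sum_distrib_right)
  finally show ?thesis .
qed

text \<open>Symmetry makes the two cross terms equal.\<close>

lemma quad_form_add:
  assumes "symmetric_n n A"
  shows "quad_form n A (\<lambda>i. x i + h i)
    = quad_form n A x + 2 * inner_n n (mat_vec n A x) h + quad_form n A h"
  unfolding quad_form_def mat_vec_add inner_n_add_left inner_n_add_right
  using inner_mat_vec_sym[OF assms, of h x] by simp

lemma quad_form_scale: "quad_form n A (\<lambda>i. c * h i) = c\<^sup>2 * quad_form n A h"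
  unfolding quad_form_def mat_vec_scale inner_n_scale_left inner_n_scale_right
  by (simp add: power2_eq_square)

lemma convex_quad_form:
  assumes "symmetric_n n A" "nonneg_definite_n n A"
  shows "convex_fun (quad_form n A)"
  unfolding convex_fun_def
proof (intro allI ballI)
  fix x y :: "nat \<Rightarrow> real" and t :: real
  assume t: "t \<in> {0..1}"
  define h where "h i = y i - x i" for i
  have "(\<lambda>i. (1 - t) * x i + t * y i) = (\<lambda>i. x i + t * h i)"
    by (simp add: h_def algebra_simps)
  then have 1: "quad_form n A (\<lambda>i. (1 - t) * x i + t * y i)
      = quad_form n A x + 2 * t * inner_n n (mat_vec n A x) h + t\<^sup>2 * quad_form n A h"
    by (simp add: quad_form_add[OF assms(1)] quad_form_scale inner_n_scale_right)
  have 2: "quad_form n A y = quad_form n A x + 2 * inner_n n (mat_vec n A x) h + quad_form n A h"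
    using quad_form_add[OF assms(1), of x h] by (simp add: h_def)
  \<comment> \<open>This quantity is exactly the gap between the two sides of the convexity
    inequality.\<close>
  have "0 \<le> t * (1 - t) * quad_form n A h"
    using assms(2) t by (simp add: nonneg_definite_n_def quad_form_def)
  then show "quad_form n A (\<lambda>i. (1 - t) * x i + t * y i)
      \<le> (1 - t) * quad_form n A x + t * quad_form n A y"
    unfolding 1 2 by (simp add: algebra_simps power2_eq_square)
qed

lemma convex_sublevel: "convex_fun f \<Longrightarrow> convex_set_n {x. f x \<le> c}"
  unfolding convex_fun_def convex_set_n_def
proof (intro ballI)
  fix x y :: "nat \<Rightarrow> real" and t :: real
  assume f: "\<forall>x y. \<forall>t\<in>{0..1}. f (\<lambda>i. (1 - t) * x i + t * y i) \<le> (1 - t) * f x + t * f y"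
    and xy: "x \<in> {x. f x \<le> c}" "y \<in> {x. f x \<le> c}" and t: "t \<in> {0..1}"
  have "f (\<lambda>i. (1 - t) * x i + t * y i) \<le> (1 - t) * f x + t * f y"
    using f t by blast
  also have "\<dots> \<le> (1 - t) * c + t * c"
    using xy t by (intro add_mono mult_left_mono) auto
  finally show "(\<lambda>i. (1 - t) * x i + t * y i) \<in> {x. f x \<le> c}"
    by (simp add: algebra_simps)
qed

lemma convex_set_n_Int: "convex_set_n C \<Longrightarrow> convex_set_n D \<Longrightarrow> convex_set_n (C \<inter> D)"
  by (simp add: convex_set_n_def)

lemma convex_cube: "convex_set_n {x. \<forall>i<n. \<bar>x i\<bar> \<le> 1}"
  unfolding convex_set_n_def
proof (intro ballI, clarsimp)
  fix x y :: "nat \<Rightarrow> real" and t :: real and i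
  assume "\<forall>i<n. \<bar>x i\<bar> \<le> 1" "\<forall>i<n. \<bar>y i\<bar> \<le> 1" "0 \<le> t" "t \<le> 1" "i < n"
  then have "(1 - t) * \<bar>x i\<bar> + t * \<bar>y i\<bar> \<le> (1 - t) * 1 + t * 1"
    by (intro add_mono mult_left_mono) auto
  moreover have "\<bar>(1 - t) * x i + t * y i\<bar> \<le> (1 - t) * \<bar>x i\<bar> + t * \<bar>y i\<bar>"
    using abs_triangle_ineq[of "(1 - t) * x i" "t * y i"] \<open>0 \<le> t\<close> \<open>t \<le> 1\<close> by (simp add: abs_mult)
  ultimately show "\<bar>(1 - t) * x i + t * y i\<bar> \<le> 1" by simp
qed

section \<open>Matrix norms and their comparison with the Hilbert-Schmidt norm\<close>

definition row_norm :: "nat \<Rightarrow> (nat \<Rightarrow> nat \<Rightarrow> real) \<Rightarrow> nat \<Rightarrow> real" where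
  "row_norm n A i = L2_set (A i) {..<n}"

lemma norm_12_eq: "norm_12 n p A = norm_1 n p (row_norm n A)"
  by (simp add: norm_12_def row_norm_def[abs_def] L2_set_def)

lemma hs_norm_eq: "hs_norm n A = L2_set (row_norm n A) {..<n}"
  by (simp add: hs_norm_def row_norm_def[abs_def] L2_set_def sum_nonneg)

text \<open>Cauchy-Schwarz in each row.\<close>

lemma L2_mat_vec_le: "L2_set (mat_vec n A x) {..<n} \<le> hs_norm n A * L2_set x {..<n}"
proof -
  have "L2_set (mat_vec n A x) {..<n} = L2_set (\<lambda>i. \<bar>inner_n n (A i) x\<bar>) {..<n}"
    by (simp add: mat_vec_def inner_n_def L2_set_abs)
  also have "\<dots> \<le> L2_set (\<lambda>i. L2_set x {..<n} * row_norm n A i) {..<n}"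
    unfolding row_norm_def
    by (intro L2_set_mono) (auto simp: inner_n_le_L2 mult.commute[of "L2_set x {..<n}"])
  also have "\<dots> = hs_norm n A * L2_set x {..<n}"
    by (simp add: L2_set_scale hs_norm_eq)
  finally show ?thesis .
qed

text \<open>Cauchy-Schwarz with \<open>\<bar>x\<bar>, \<bar>y\<bar> \<le> sqrt p\<close>. The bound
  shows that the supremum in \<open>norm_1_2\<close> is taken over a bounded set, and it also
  estimates that supremum.\<close>

lemma bilinear_le_hs:
  assumes "p \<ge> 0" "x \<in> test_set n p" "y \<in> test_set n p"
  shows "inner_n n (mat_vec n A x) y \<le> p * hs_norm n A"
proof -
  have "inner_n n (mat_vec n A x) y \<le> sqrt p * L2_set (mat_vec n A x) {..<n}"
    by (rule inner_n_test_set_le[OF assms(3)])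
  also have "\<dots> \<le> sqrt p * (hs_norm n A * sqrt p)"
    using assms L2_mat_vec_le[of n A x]
    by (intro mult_left_mono order_trans[OF L2_mat_vec_le]) (auto simp: test_set_def hs_norm_eq)
  also have "\<dots> = (sqrt p * sqrt p) * hs_norm n A"
    by (simp only: mult_ac)
  finally show ?thesis
    using assms(1) by simp
qed

lemma norm_1_2_eq:
  assumes "n \<ge> 1"
  shows "norm_1_2 n p A = (SUP (x, y)\<in>test_set n p \<times> test_set n p. inner_n n (mat_vec n A y) x)"
proof -
  have "(\<Sum>i<n. \<Sum>j<n. A i j * x i * y j) = inner_n n (mat_vec n A y) x" for x y
    by (simp add: inner_n_def mat_vec_def sum_distrib_right sum_distrib_left mult_ac)
  then show ?thesis
    unfolding norm_1_2_def max_norm_le_iff[OF assms] test_set_def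
    by (intro arg_cong[of _ _ Sup]) (auto simp: image_iff)
qed

lemma norm_1_2_upper:
  assumes "n \<ge> 1" "p \<ge> 0" "x \<in> test_set n p" "y \<in> test_set n p"
  shows "inner_n n (mat_vec n A y) x \<le> norm_1_2 n p A"
proof -
  have "bdd_above ((\<lambda>(x, y). inner_n n (mat_vec n A y) x) ` (test_set n p \<times> test_set n p))"
    by (intro bdd_aboveI[of _ "p * hs_norm n A"]) (auto intro: bilinear_le_hs assms)
  from cSUP_upper[OF _ this, of "(x, y)"] show ?thesis
    using assms by (simp add: norm_1_2_eq)
qed

lemma norm_1_2_nonneg:
  assumes "n \<ge> 1" "p \<ge> 0"
  shows "0 \<le> norm_1_2 n p A"
  using norm_1_2_upper[OF assms zero_in_test_set zero_in_test_set, of A] assms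
  by (simp add: inner_n_def)

lemma norm_1_2_le:
  assumes "n \<ge> 1" "p \<ge> 0"
  shows "norm_1_2 n p A \<le> p * hs_norm n A"
  unfolding norm_1_2_eq[OF assms(1)]
  using zero_in_test_set[OF assms(2), of n]
  by (intro cSUP_least) (auto intro: bilinear_le_hs assms)

section \<open>A convex majorant for the supremum over test vectors\<close>

text \<open>An explicit substitute for the supremum of \<open>inner_n n v y\<close> over the test
  set. Unlike the supremum, its mean at a random \<open>v\<close> is controlled by second moments of
  the coordinates.\<close>

definition split_norm :: "nat \<Rightarrow> real \<Rightarrow> nat set \<Rightarrow> (nat \<Rightarrow> real) \<Rightarrow> real" where
  "split_norm n p I v = (\<Sum>i\<in>I. \<bar>v i\<bar>) + sqrt p * L2_set v ({..<n} - I)"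

text \<open>On \<open>I\<close> the constraint \<open>\<bar>y i\<bar> \<le> 1\<close> is used, off
  \<open>I\<close> Cauchy-Schwarz with \<open>\<bar>y\<bar> \<le> sqrt p\<close>.\<close>

lemma inner_n_le_split_norm:
  assumes "y \<in> test_set n p" "I \<subseteq> {..<n}"
  shows "inner_n n v y \<le> split_norm n p I v"
proof -
  have "inner_n n v y = (\<Sum>i\<in>I. v i * y i) + (\<Sum>i\<in>{..<n} - I. v i * y i)"
    unfolding inner_n_def using assms(2) by (simp add: sum.subset_diff[of I] add.commute)
  also have "(\<Sum>i\<in>I. v i * y i) \<le> (\<Sum>i\<in>I. \<bar>v i\<bar>)"
  proof (rule sum_mono)
    fix i assume "i \<in> I"
    then have "\<bar>v i\<bar> * \<bar>y i\<bar> \<le> \<bar>v i\<bar> * 1"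
      using assms by (intro mult_left_mono) (auto simp: test_set_def)
    then show "v i * y i \<le> \<bar>v i\<bar>"
      using abs_ge_self[of "v i * y i"] by (simp add: abs_mult)
  qed
  also have "(\<Sum>i\<in>{..<n} - I. v i * y i) \<le> (\<Sum>i\<in>{..<n} - I. \<bar>v i\<bar> * \<bar>y i\<bar>)"
    by (intro sum_mono) (metis abs_ge_self abs_mult)
  also have "\<dots> \<le> L2_set v ({..<n} - I) * L2_set y ({..<n} - I)"
    by (rule L2_set_mult_ineq)
  also have "\<dots> \<le> L2_set v ({..<n} - I) * sqrt p"
  proof (rule mult_left_mono)
    have "L2_set y ({..<n} - I) \<le> L2_set y {..<n}"
      unfolding L2_set_def by (intro real_sqrt_le_mono sum_mono2) auto
    then show "L2_set y ({..<n} - I) \<le> sqrt p"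
      using assms(1) by (simp add: test_set_def)
  qed simp
  finally show ?thesis
    by (simp add: split_norm_def mult.commute)
qed

lemma split_norm_nonneg: "p \<ge> 0 \<Longrightarrow> 0 \<le> split_norm n p I v"
  by (simp add: split_norm_def sum_nonneg)

text \<open>A nonnegative combination of seminorms, composed with a linear map.\<close>

lemma convex_split_norm_mat_vec:
  assumes "p \<ge> 0"
  shows "convex_fun (\<lambda>x. split_norm n p I (mat_vec n A x))"
  unfolding convex_fun_def
proof (intro allI ballI)
  fix x y :: "nat \<Rightarrow> real" and t :: real
  assume t: "t \<in> {0..1}"
  let ?v = "mat_vec n A x" and ?w = "mat_vec n A y"
  have lin: "mat_vec n A (\<lambda>i. (1 - t) * x i + t * y i) = (\<lambda>i. (1 - t) * ?v i + t * ?w i)"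
    by (rule ext) (simp only: mat_vec_add mat_vec_scale)
  have "(\<Sum>i\<in>I. \<bar>(1 - t) * ?v i + t * ?w i\<bar>) \<le> (\<Sum>i\<in>I. (1 - t) * \<bar>?v i\<bar> + t * \<bar>?w i\<bar>)"
    using t by (intro sum_mono order_trans[OF abs_triangle_ineq]) (simp add: abs_mult)
  also have "\<dots> = (1 - t) * (\<Sum>i\<in>I. \<bar>?v i\<bar>) + t * (\<Sum>i\<in>I. \<bar>?w i\<bar>)"
    by (simp add: sum.distrib sum_distrib_left)
  finally have 1: "(\<Sum>i\<in>I. \<bar>(1 - t) * ?v i + t * ?w i\<bar>) \<le> \<dots>" .
  have "L2_set (\<lambda>i. (1 - t) * ?v i + t * ?w i) ({..<n} - I)
      \<le> (1 - t) * L2_set ?v ({..<n} - I) + t * L2_set ?w ({..<n} - I)"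
    using L2_set_triangle_ineq[of "\<lambda>i. (1 - t) * ?v i" "\<lambda>i. t * ?w i" "{..<n} - I"] t
    by (simp add: L2_set_scale)
  then have "sqrt p * L2_set (\<lambda>i. (1 - t) * ?v i + t * ?w i) ({..<n} - I)
      \<le> sqrt p * ((1 - t) * L2_set ?v ({..<n} - I) + t * L2_set ?w ({..<n} - I))"
    using assms by (intro mult_left_mono) auto
  with 1 show "split_norm n p I (mat_vec n A (\<lambda>i. (1 - t) * x i + t * y i))
      \<le> (1 - t) * split_norm n p I ?v + t * split_norm n p I ?w"
    unfolding split_norm_def lin by (simp add: algebra_simps)
qed

section \<open>Consequences of convex concentration\<close>

text \<open>This fixes the constant 2 in the radius \<open>K * (2 + sqrt p)\<close> used below: an
  event of probability 1/4 outweighs the tail \<open>2 * exp (- 2\<^sup>2)\<close>.\<close>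

lemma exp_minus_four_less: "2 * exp (- 4) < (1 / 4 :: real)"
proof -
  have "3 * 3 \<le> exp 2 * exp (2 :: real)"
    using exp_ge_add_one_self[of 2] by (intro mult_mono) auto
  then have "9 \<le> exp (4 :: real)"
    by (simp flip: exp_add)
  then show ?thesis by (simp add: exp_minus field_simps)
qed

text \<open>A nonzero matrix has positive Hilbert-Schmidt norm, which allows division by
  \<open>norm_12\<close> and strict thresholds in the tail bounds.\<close>

locale concentrated_quadratic_form = prob_space M for M :: "'a measure" +
  fixes n :: nat and X :: "'a \<Rightarrow> nat \<Rightarrow> real" and K :: real and A :: "nat \<Rightarrow> nat \<Rightarrow> real"
  assumes n_pos: "n \<ge> 1" and K_pos: "K > 0"
    and X_vec: "centered_bounded_vector M n X"
    and conc: "convex_concentration M n X K"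
    and A_sym: "symmetric_n n A" and A_psd: "nonneg_definite_n n A"
    and A_nonzero: "\<exists>i<n. \<exists>j<n. A i j \<noteq> 0"
begin

lemma X_measurable: "i < n \<Longrightarrow> (\<lambda>\<omega>. X \<omega> i) \<in> borel_measurable M"
  using X_vec by (simp add: centered_bounded_vector_def random_vector_def)

lemma X_bounded: "\<omega> \<in> space M \<Longrightarrow> i < n \<Longrightarrow> \<bar>X \<omega> i\<bar> \<le> 1"
  using X_vec by (fastforce simp: centered_bounded_vector_def abs_le_iff)

lemma X_centered: "i < n \<Longrightarrow> expectation (\<lambda>\<omega>. X \<omega> i) = 0"
  using X_vec by (simp add: centered_bounded_vector_def)

lemma X_integrable: "i < n \<Longrightarrow> integrable M (\<lambda>\<omega>. X \<omega> i)"
  by (rule integrable_const_bound[of _ 1]) (auto simp: X_bounded X_measurable)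

lemma inner_measurable: "(\<lambda>\<omega>. inner_n n a (X \<omega>)) \<in> borel_measurable M"
  unfolding inner_n_def by (intro borel_measurable_sum borel_measurable_times) (auto simp: X_measurable)

lemma inner_bounded:
  assumes "\<omega> \<in> space M"
  shows "\<bar>inner_n n a (X \<omega>)\<bar> \<le> (\<Sum>i<n. \<bar>a i\<bar>)"
proof -
  have "\<bar>a i * X \<omega> i\<bar> \<le> \<bar>a i\<bar>" if "i < n" for i
    using mult_left_mono[OF X_bounded[OF assms that], of "\<bar>a i\<bar>"] by (simp add: abs_mult)
  then show ?thesis
    unfolding inner_n_def by (intro order_trans[OF sum_abs] sum_mono) auto
qed

lemma inner_centered: "expectation (\<lambda>\<omega>. inner_n n a (X \<omega>)) = 0"
  unfolding inner_n_def
  by (subst Bochner_Integration.integral_sum) (auto simp: X_integrable X_centered)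

text \<open>A linear functional is convex and Lipschitz with constant \<open>\<bar>a\<bar>\<close>,
  so it has Gaussian tails around a median. Integrating them bounds the second moment about the
  median, which exceeds the one about the mean 0.\<close>

lemma inner_second_moment:
  "expectation (\<lambda>\<omega>. (inner_n n a (X \<omega>))\<^sup>2) \<le> 4 * K\<^sup>2 * (L2_set a {..<n})\<^sup>2"
proof (cases "L2_set a {..<n} = 0")
  case True
  then have "inner_n n a x = 0" for x
    using inner_n_le_L2[of n a x] by simp
  then show ?thesis by simp
next
  case False
  define L where "L = L2_set a {..<n}"
  have "L > 0"
    using False L2_set_nonneg[of a "{..<n}"] unfolding L_def by linarith
  define Y where "Y \<omega> = inner_n n a (X \<omega>)" for \<omega>
  define S where "S = (\<Sum>i<n. \<bar>a i\<bar>)"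
  have [measurable]: "Y \<in> borel_measurable M"
    unfolding Y_def by (rule inner_measurable)
  have YS: "\<bar>Y \<omega>\<bar> \<le> S" if "\<omega> \<in> space M" for \<omega>
    using inner_bounded[OF that] by (simp add: Y_def S_def)
  have "lipschitz_n n L (inner_n n a)"
    unfolding lipschitz_n_def
  proof (intro allI)
    fix x y
    have "inner_n n a x - inner_n n a y = inner_n n a (\<lambda>i. x i - y i)"
      by (simp add: inner_n_def algebra_simps sum_subtractf)
    then show "\<bar>inner_n n a x - inner_n n a y\<bar> \<le> L * L2_set (\<lambda>i. x i - y i) {..<n}"
      unfolding L_def by (metis inner_n_le_L2)
  qed
  moreover have "convex_fun (inner_n n a)"
    unfolding convex_fun_def inner_n_add_right inner_n_scale_right by simp
  ultimately obtain m where m: "\<And>t. t > 0 \<Longrightarrow>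
      \<P>(\<omega> in M. \<bar>Y \<omega> - m\<bar> \<ge> t) \<le> 2 * exp (- t\<^sup>2 / (K\<^sup>2 * L\<^sup>2))"
    using conc \<open>L > 0\<close> unfolding convex_concentration_def Y_def by blast
  have int: "integrable M Y" "integrable M (\<lambda>\<omega>. (Y \<omega>)\<^sup>2)"
  proof -
    show "integrable M Y"
      by (rule integrable_const_bound[of _ S]) (auto simp: YS)
    show "integrable M (\<lambda>\<omega>. (Y \<omega>)\<^sup>2)"
      by (rule integrable_const_bound[of _ "S\<^sup>2"])
        (auto intro!: AE_I2 abs_le_square_iff[THEN iffD1] order_trans[OF YS])
  qed
  have "expectation (\<lambda>\<omega>. (Y \<omega> - m)\<^sup>2) \<le> 2 * 2 * (K\<^sup>2 * L\<^sup>2)"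
  proof (rule expectation_le_exponential_tail)
    show "(Y \<omega> - m)\<^sup>2 \<le> (S + \<bar>m\<bar>)\<^sup>2" if "\<omega> \<in> space M" for \<omega>
      using YS[OF that] by (intro abs_le_square_iff[THEN iffD1]) linarith
    show "\<P>(\<omega> in M. (Y \<omega> - m)\<^sup>2 \<ge> K\<^sup>2 * L\<^sup>2 * real k) \<le> 2 * exp (- real k)" for k :: nat
    proof (cases "k = 0")
      case True
      then show ?thesis
        by (simp add: prob_space)
    next
      case False
      \<comment> \<open>Chosen so that the Gaussian bound at \<open>t\<close> becomes
        \<open>2 * exp (- real k)\<close>; this requires \<open>t > 0\<close>, hence the separate
        case \<open>k = 0\<close>.\<close>
      define t where "t = K * L * sqrt k"
      have t: "t > 0" "t\<^sup>2 = K\<^sup>2 * L\<^sup>2 * real k"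
        using False K_pos \<open>L > 0\<close> by (auto simp: t_def power_mult_distrib)
      have "(K\<^sup>2 * L\<^sup>2 * real k \<le> (Y \<omega> - m)\<^sup>2) = (t \<le> \<bar>Y \<omega> - m\<bar>)" for \<omega>
        using t(1) abs_le_square_iff[of t "Y \<omega> - m"] unfolding t(2) by simp
      moreover have "- t\<^sup>2 / (K\<^sup>2 * L\<^sup>2) = - real k"
        using K_pos \<open>L > 0\<close> by (simp add: t(2))
      ultimately show ?thesis
        using m[OF t(1)] by simp
    qed
  qed (use K_pos \<open>L > 0\<close> in auto)
  moreover have "expectation (\<lambda>\<omega>. (Y \<omega> - m)\<^sup>2) = expectation (\<lambda>\<omega>. (Y \<omega>)\<^sup>2) + m\<^sup>2"
  proof -
    have "expectation (\<lambda>\<omega>. (Y \<omega> - m)\<^sup>2) = expectation (\<lambda>\<omega>. (Y \<omega>)\<^sup>2 - 2 * m * Y \<omega> + m\<^sup>2)"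
      by (simp add: power2_diff algebra_simps)
    also have "\<dots> = expectation (\<lambda>\<omega>. (Y \<omega>)\<^sup>2) - 2 * m * expectation Y + m\<^sup>2"
      using int by (simp add: prob_space)
    finally show ?thesis
      using inner_centered[of a] by (simp add: Y_def[abs_def])
  qed
  ultimately show ?thesis
    unfolding Y_def[symmetric] L_def[symmetric] using zero_le_power2[of m] by linarith
qed

text \<open>The distance to \<open>D\<close> is convex and 1-Lipschitz, so it concentrates around a
  median. As it vanishes on the likely event \<open>X \<omega> \<in> D\<close>, that median is at
  most \<open>K * u\<close>.\<close>

lemma prob_dist_ge:
  assumes D: "convex_set_n D" "\<P>(\<omega> in M. X \<omega> \<in> D) > 2 * exp (- u\<^sup>2)" and "u \<ge> 0" "t > 0"
  shows "\<P>(\<omega> in M. dist_n n D (X \<omega>) \<ge> K * (u + t)) \<le> 2 * exp (- t\<^sup>2)"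
proof -
  have "D \<noteq> {}"
  proof
    assume "D = {}"
    with D(2) have "2 * exp (- u\<^sup>2) < 0" by simp
    then show False by (simp add: not_less)
  qed
  define Y where "Y \<omega> = dist_n n D (X \<omega>)" for \<omega>
  have lip: "lipschitz_n n 1 (dist_n n D)"
    by (rule lipschitz_dist_n[OF \<open>D \<noteq> {}\<close>])
  have [measurable]: "Y \<in> borel_measurable M"
    unfolding Y_def
    using X_vec by (intro lipschitz_n_measurable[OF _ lip]) (simp add: centered_bounded_vector_def)
  obtain m where m: "\<And>t. t > 0 \<Longrightarrow> \<P>(\<omega> in M. \<bar>Y \<omega> - m\<bar> \<ge> t) \<le> 2 * exp (- t\<^sup>2 / K\<^sup>2)"
    using conc[unfolded convex_concentration_def, rule_format,
      OF zero_less_one lip convex_dist_n[OF \<open>D \<noteq> {}\<close> D(1)]]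
    unfolding Y_def by auto
  \<comment> \<open>Otherwise all of \<open>D\<close> would deviate from \<open>m\<close> by
    \<open>m \<ge> K * u\<close>, which is too unlikely.\<close>
  have "m < K * u \<or> m \<le> 0"
  proof (rule ccontr)
    assume "\<not> ?thesis"
    then have "m > 0" "K * u \<le> m" by auto
    have "\<P>(\<omega> in M. X \<omega> \<in> D) \<le> \<P>(\<omega> in M. \<bar>Y \<omega> - m\<bar> \<ge> m)"
    proof (rule finite_measure_mono)
      show "{\<omega> \<in> space M. X \<omega> \<in> D} \<subseteq> {\<omega> \<in> space M. \<bar>Y \<omega> - m\<bar> \<ge> m}"
        by (auto simp: Y_def dist_n_member)
    qed measurable
    also have "\<dots> \<le> 2 * exp (- m\<^sup>2 / K\<^sup>2)"
      by (rule m[OF \<open>m > 0\<close>])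
    also have "\<dots> \<le> 2 * exp (- u\<^sup>2)"
    proof -
      have "(K * u)\<^sup>2 \<le> m\<^sup>2"
        using \<open>K * u \<le> m\<close> K_pos \<open>u \<ge> 0\<close> by (intro power_mono) auto
      then show ?thesis
        using K_pos by (simp add: power_mult_distrib field_simps)
    qed
    finally show False using D(2) by simp
  qed
  then have "m \<le> K * u"
    using K_pos \<open>u \<ge> 0\<close> by (meson less_imp_le mult_nonneg_nonneg order_trans)
  have "\<P>(\<omega> in M. Y \<omega> \<ge> K * (u + t)) \<le> \<P>(\<omega> in M. \<bar>Y \<omega> - m\<bar> \<ge> K * t)"
    using \<open>m \<le> K * u\<close> by (intro finite_measure_mono) (auto simp: algebra_simps)
  also have "\<dots> \<le> 2 * exp (- t\<^sup>2)"
    using m[of "K * t"] K_pos \<open>t > 0\<close> by (simp add: power_mult_distrib)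
  finally show ?thesis by (simp add: Y_def)
qed

section \<open>A convex function dominating the gradient term\<close>

lemma hs_norm_pos: "hs_norm n A > 0"
proof -
  obtain i j where ij: "i < n" "j < n" "A i j \<noteq> 0" using A_nonzero by blast
  have "0 < \<bar>A i j\<bar>" using ij by simp
  also have "\<dots> \<le> row_norm n A i"
    using member_le_L2_set[of "{..<n}" j "\<lambda>j. \<bar>A i j\<bar>"] ij by (simp add: L2_set_abs row_norm_def)
  also have "\<dots> \<le> hs_norm n A"
    using member_le_L2_set[of "{..<n}" i "row_norm n A"] ij by (simp add: hs_norm_eq)
  finally show ?thesis .
qed

text \<open>
  The function \<open>g\<close> controls the linear term \<open>2 \<langle>A d, X - d\<rangle>\<close> in the expansion of the form
  around a point \<open>d\<close>; being convex, it can be bounded on \<open>d\<close> as well as on \<open>X\<close>.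
\<close>

lemma gradient_majorant:
  assumes "p \<ge> 1"
  obtains g where "convex_fun g" "(\<lambda>\<omega>. g (X \<omega>)) \<in> borel_measurable M"
    "\<And>x y. y \<in> test_set n p \<Longrightarrow> inner_n n (mat_vec n A x) y \<le> g x"
    "\<P>(\<omega> in M. g (X \<omega>) > 24 * K * norm_12 n p A) \<le> 1 / 4"
proof -
  let ?r = "row_norm n A"
  define N where "N = norm_12 n p A"
  have "N > 0"
    using L2_le_norm_1[OF n_pos assms, of ?r] hs_norm_pos by (simp add: N_def norm_12_eq hs_norm_eq)
  \<comment> \<open>The index set depends on the row norms only, not on the point at which
    \<open>g\<close> is evaluated, so \<open>g\<close> is convex and its mean splits into two
    parts.\<close>
  obtain I where I: "I \<subseteq> {..<n}" "sum ?r I + sqrt p * L2_set ?r ({..<n} - I) \<le> 3 * norm_1 n p ?r"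
    by (rule norm_1_decomposition[OF n_pos assms, of ?r]) (auto simp: row_norm_def)
  define g where "g x = split_norm n p I (mat_vec n A x)" for x
  have mv: "mat_vec n A x i = inner_n n (A i) x" for x i
    by (simp add: mat_vec_def inner_n_def)
  note [measurable] = inner_measurable
  have inner_int: "integrable M (\<lambda>\<omega>. \<bar>inner_n n a (X \<omega>)\<bar>)"
    "integrable M (\<lambda>\<omega>. (inner_n n a (X \<omega>))\<^sup>2)" for a
    by (rule integrable_const_bound[of _ "\<Sum>i<n. \<bar>a i\<bar>"], auto simp: inner_bounded)
      (rule integrable_const_bound[of _ "(\<Sum>i<n. \<bar>a i\<bar>)\<^sup>2"],
        auto intro!: AE_I2 abs_le_square_iff[THEN iffD1] order_trans[OF inner_bounded])
  have L2_meas [measurable]: "(\<lambda>\<omega>. L2_set (mat_vec n A (X \<omega>)) J) \<in> borel_measurable M" for J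
    unfolding L2_set_def mv by measurable
  have sq: "(L2_set (mat_vec n A (X \<omega>)) J)\<^sup>2 = (\<Sum>i\<in>J. (inner_n n (A i) (X \<omega>))\<^sup>2)" for \<omega> J
    by (simp add: L2_set_def mv sum_nonneg)
  have L2_int: "integrable M (\<lambda>\<omega>. L2_set (mat_vec n A (X \<omega>)) J)" if "finite J" for J
  proof (rule integrable_const_bound)
    show "AE \<omega> in M. norm (L2_set (mat_vec n A (X \<omega>)) J) \<le> L2_set (\<lambda>i. \<Sum>j<n. \<bar>A i j\<bar>) J"
    proof (rule AE_I2)
      fix \<omega> assume "\<omega> \<in> space M"
      have "L2_set (\<lambda>i. \<bar>mat_vec n A (X \<omega>) i\<bar>) J \<le> L2_set (\<lambda>i. \<Sum>j<n. \<bar>A i j\<bar>) J"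
        unfolding mv using inner_bounded[OF \<open>\<omega> \<in> space M\<close>] by (intro L2_set_mono) auto
      then show "norm (L2_set (mat_vec n A (X \<omega>)) J) \<le> L2_set (\<lambda>i. \<Sum>j<n. \<bar>A i j\<bar>) J"
        by (simp add: L2_set_abs)
    qed
  qed measurable
  have E_inner: "expectation (\<lambda>\<omega>. \<bar>inner_n n (A i) (X \<omega>)\<bar>) \<le> 2 * K * ?r i" for i
  proof -
    have "expectation (\<lambda>\<omega>. \<bar>inner_n n (A i) (X \<omega>)\<bar>)
        \<le> sqrt (expectation (\<lambda>\<omega>. \<bar>inner_n n (A i) (X \<omega>)\<bar>\<^sup>2))"
      using inner_int by (intro expectation_le_sqrt_second_moment) auto
    also have "\<dots> \<le> sqrt ((2 * K * ?r i)\<^sup>2)"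
      using inner_second_moment[of "A i"] by (simp add: row_norm_def power_mult_distrib)
    finally show ?thesis using K_pos by (simp add: row_norm_def)
  qed
  have E_L2: "expectation (\<lambda>\<omega>. L2_set (mat_vec n A (X \<omega>)) J) \<le> 2 * K * L2_set ?r J" if "finite J" for J
  proof -
    have "expectation (\<lambda>\<omega>. L2_set (mat_vec n A (X \<omega>)) J)
        \<le> sqrt (expectation (\<lambda>\<omega>. (L2_set (mat_vec n A (X \<omega>)) J)\<^sup>2))"
      using inner_int L2_int[OF that]
      by (intro expectation_le_sqrt_second_moment) (auto simp: sq)
    also have "expectation (\<lambda>\<omega>. (L2_set (mat_vec n A (X \<omega>)) J)\<^sup>2)
        = (\<Sum>i\<in>J. expectation (\<lambda>\<omega>. (inner_n n (A i) (X \<omega>))\<^sup>2))"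
      using inner_int by (simp add: sq)
    also have "\<dots> \<le> (\<Sum>i\<in>J. 4 * K\<^sup>2 * (?r i)\<^sup>2)"
      unfolding row_norm_def by (intro sum_mono inner_second_moment)
    also have "\<dots> = (2 * K * L2_set ?r J)\<^sup>2"
      by (simp add: L2_set_def power_mult_distrib sum_nonneg sum_distrib_left)
    finally show ?thesis using K_pos by simp
  qed
  have g_eq: "g (X \<omega>) = (\<Sum>i\<in>I. \<bar>inner_n n (A i) (X \<omega>)\<bar>)
      + sqrt p * L2_set (mat_vec n A (X \<omega>)) ({..<n} - I)" for \<omega>
    by (simp add: g_def split_norm_def mv)
  have g_int: "integrable M (\<lambda>\<omega>. g (X \<omega>))"
    unfolding g_eq by (intro Bochner_Integration.integrable_add
      Bochner_Integration.integrable_sum integrable_mult_right inner_int L2_int) auto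
  have "expectation (\<lambda>\<omega>. g (X \<omega>)) = (\<Sum>i\<in>I. expectation (\<lambda>\<omega>. \<bar>inner_n n (A i) (X \<omega>)\<bar>))
      + sqrt p * expectation (\<lambda>\<omega>. L2_set (mat_vec n A (X \<omega>)) ({..<n} - I))"
    unfolding g_eq using inner_int L2_int
    by (subst Bochner_Integration.integral_add) (auto simp: Bochner_Integration.integral_sum)
  \<comment> \<open>Each mean costs a factor \<open>2 * K\<close> by the second moment bound; what
    remains is the decomposition of the row norms, at most \<open>3 * N\<close>.\<close>
  also have "\<dots> \<le> (\<Sum>i\<in>I. 2 * K * ?r i) + sqrt p * (2 * K * L2_set ?r ({..<n} - I))"
    using assms by (intro add_mono sum_mono mult_left_mono E_inner E_L2) auto
  also have "\<dots> = 2 * K * (sum ?r I + sqrt p * L2_set ?r ({..<n} - I))"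
    by (simp add: sum_distrib_left algebra_simps)
  also have "\<dots> \<le> 2 * K * (3 * N)"
    using I(2) K_pos by (intro mult_left_mono) (auto simp: N_def norm_12_eq)
  finally have Eg: "expectation (\<lambda>\<omega>. g (X \<omega>)) \<le> 6 * K * N" by simp
  have g_meas [measurable]: "(\<lambda>\<omega>. g (X \<omega>)) \<in> borel_measurable M"
    using g_int by simp
  \<comment> \<open>Markov's inequality at four times the bound \<open>6 * K * N\<close> on the
    mean.\<close>
  have "\<P>(\<omega> in M. g (X \<omega>) > 24 * K * N) \<le> \<P>(\<omega> in M. g (X \<omega>) \<ge> 24 * K * N)"
    by (intro finite_measure_mono) auto
  also have "\<dots> \<le> expectation (\<lambda>\<omega>. g (X \<omega>)) / (24 * K * N)"
    using g_int K_pos \<open>N > 0\<close> assms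
    by (intro integral_Markov_inequality_measure[where A = "{}"])
      (auto simp: g_def split_norm_nonneg)
  also have "\<dots> \<le> 6 * K * N / (24 * K * N)"
    using Eg K_pos \<open>N > 0\<close> by (intro divide_right_mono) auto
  also have "\<dots> = 1 / 4"
    using K_pos \<open>N > 0\<close> by simp
  finally have "\<P>(\<omega> in M. g (X \<omega>) > 24 * K * N) \<le> 1 / 4" .
  moreover have "convex_fun g"
    unfolding g_def using assms by (intro convex_split_norm_mat_vec) simp
  moreover have "inner_n n (mat_vec n A x) y \<le> g x" if "y \<in> test_set n p" for x y
    unfolding g_def using that I(1) by (rule inner_n_le_split_norm)
  ultimately show ?thesis
    using that[of g] g_meas by (simp add: N_def)
qed

section \<open>Tail bounds around a median of the quadratic form\<close>

lemma hs_norm_le_norm_12: "p \<ge> 1 \<Longrightarrow> hs_norm n A \<le> norm_12 n p A"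
  using L2_le_norm_1[OF n_pos] by (simp add: norm_12_eq hs_norm_eq)

lemma norm_12_le_hs_norm: "p \<ge> 0 \<Longrightarrow> norm_12 n p A \<le> sqrt p * hs_norm n A"
  using norm_1_le[OF n_pos] by (simp add: norm_12_eq hs_norm_eq)

lemma quad_form_measurable: "(\<lambda>\<omega>. quad_form n A (X \<omega>)) \<in> borel_measurable M"
  unfolding quad_form_def
  by (simp add: inner_n_def mat_vec_def)
    (intro borel_measurable_sum borel_measurable_times borel_measurable_const X_measurable, auto)

lemma quad_form_bounded:
  assumes "\<omega> \<in> space M"
  shows "\<bar>quad_form n A (X \<omega>)\<bar> \<le> hs_norm n A * n"
proof -
  have "(\<Sum>i<n. (X \<omega> i)\<^sup>2) \<le> (\<Sum>i<n. 1)"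
    using X_bounded[OF assms] by (intro sum_mono) (auto simp: abs_square_le_1)
  then have X: "L2_set (X \<omega>) {..<n} \<le> sqrt n"
    by (simp add: L2_set_def)
  have "\<bar>quad_form n A (X \<omega>)\<bar> \<le> L2_set (mat_vec n A (X \<omega>)) {..<n} * L2_set (X \<omega>) {..<n}"
    unfolding quad_form_def by (rule inner_n_le_L2)
  also have "\<dots> \<le> (hs_norm n A * L2_set (X \<omega>) {..<n}) * L2_set (X \<omega>) {..<n}"
    by (intro mult_right_mono L2_mat_vec_le) simp
  also have "\<dots> \<le> (hs_norm n A * sqrt n) * sqrt n"
    using X hs_norm_pos by (intro mult_mono mult_left_mono) auto
  finally show ?thesis by (simp add: mult.assoc)
qed

text \<open>For \<open>p \<ge> 1\<close> a displacement inside the cube of length below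
  \<open>K * (2 + sqrt p) \<le> 3 * K * sqrt p\<close> has coordinates at most 2, so division by
  \<open>scale\<close> turns it into a test vector.\<close>

definition scale where "scale = max (3 * K) 2"

lemma scale_pos: "scale > 0"
  by (simp add: scale_def)

lemma displacement_in_test_set:
  assumes "p \<ge> 1" "\<And>i. i < n \<Longrightarrow> \<bar>x i\<bar> \<le> 1" "\<And>i. i < n \<Longrightarrow> \<bar>d i\<bar> \<le> 1"
    and "L2_set (\<lambda>i. x i - d i) {..<n} < K * (2 + sqrt p)"
  obtains y where "y \<in> test_set n p" "\<And>i. x i = d i + scale * y i"
proof
  define y where "y i = 1 / scale * (x i - d i)" for i
  show "x i = d i + scale * y i" for i
    using scale_pos by (simp add: y_def)
  have "L2_set y {..<n} = L2_set (\<lambda>i. x i - d i) {..<n} / scale"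
    unfolding y_def using scale_pos by (subst L2_set_scale) auto
  also have "\<dots> \<le> sqrt p"
  proof -
    have "K * (2 + sqrt p) \<le> K * (3 * sqrt p)"
      using K_pos assms(1) by (intro mult_left_mono) auto
    also have "\<dots> = (3 * K) * sqrt p" by simp
    also have "\<dots> \<le> scale * sqrt p"
      using assms(1) by (intro mult_right_mono) (auto simp: scale_def)
    finally show ?thesis
      using assms(4) scale_pos by (simp add: field_simps)
  qed
  finally have "L2_set y {..<n} \<le> sqrt p" .
  moreover have "\<bar>y i\<bar> \<le> 1" if "i < n" for i
  proof -
    have "\<bar>x i - d i\<bar> \<le> 2"
      using assms(2,3)[OF that] by linarith
    also have "2 \<le> scale" by (simp add: scale_def)
    finally show ?thesis
      using scale_pos by (simp add: y_def abs_mult)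
  qed
  ultimately show "y \<in> test_set n p" by (simp add: test_set_def)
qed

text \<open>The form is expanded around a point \<open>d\<close> of \<open>D\<close> close to
  \<open>X\<close>, where both its value and its gradient are under control.\<close>

lemma upper_tail_median:
  assumes p: "p \<ge> 1" and m: "is_median M (\<lambda>\<omega>. quad_form n A (X \<omega>)) m"
    and s: "s > 48 * K * scale * norm_12 n p A + scale\<^sup>2 * norm_1_2 n p A"
  shows "\<P>(\<omega> in M. quad_form n A (X \<omega>) \<ge> m + s) \<le> 2 * exp (- p)"
proof -
  note [measurable] = quad_form_measurable
  define N where "N = norm_12 n p A"
  obtain g where g: "convex_fun g" "(\<lambda>\<omega>. g (X \<omega>)) \<in> borel_measurable M"
    "\<And>x y. y \<in> test_set n p \<Longrightarrow> inner_n n (mat_vec n A x) y \<le> g x"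
    "\<P>(\<omega> in M. g (X \<omega>) > 24 * K * N) \<le> 1 / 4"
    unfolding N_def using gradient_majorant[OF p] by blast
  note [measurable] = g(2)
  \<comment> \<open>Intersecting with the cube costs no probability, as \<open>X\<close> stays in
    it, and it bounds the coordinates of \<open>X - d\<close>.\<close>
  define D where "D = {x. \<forall>i<n. \<bar>x i\<bar> \<le> 1} \<inter> ({x. quad_form n A x \<le> m} \<inter> {x. g x \<le> 24 * K * N})"
  have D: "convex_set_n D"
    unfolding D_def
    by (intro convex_set_n_Int convex_cube convex_sublevel convex_quad_form A_sym A_psd g(1))
  have XD: "{\<omega> \<in> space M. X \<omega> \<in> D} = {\<omega> \<in> space M. quad_form n A (X \<omega>) \<le> m \<and> g (X \<omega>) \<le> 24 * K * N}"
    by (auto simp: D_def X_bounded)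
  \<comment> \<open>The median event loses at most 1/4 through the bound on \<open>g\<close>, so
    \<open>D\<close> keeps probability 1/4.\<close>
  have "1 / 2 \<le> \<P>(\<omega> in M. quad_form n A (X \<omega>) \<le> m)"
    using m by (simp add: is_median_def)
  also have "\<dots> \<le> measure M ({\<omega> \<in> space M. X \<omega> \<in> D} \<union> {\<omega> \<in> space M. g (X \<omega>) > 24 * K * N})"
    unfolding XD by (intro finite_measure_mono) auto
  also have "\<dots> \<le> \<P>(\<omega> in M. X \<omega> \<in> D) + \<P>(\<omega> in M. g (X \<omega>) > 24 * K * N)"
    unfolding XD by (intro measure_Un_le) measurable
  finally have "1 / 4 \<le> \<P>(\<omega> in M. X \<omega> \<in> D)"
    using g(4) by linarith
  then have prob_D: "\<P>(\<omega> in M. X \<omega> \<in> D) > 2 * exp (- 2\<^sup>2)"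
    using exp_minus_four_less by simp
  then have "D \<noteq> {}"
    by (intro notI) (simp add: not_less)
  have "lipschitz_n n 1 (dist_n n D)"
    by (rule lipschitz_dist_n[OF \<open>D \<noteq> {}\<close>])
  then have [measurable]: "(\<lambda>\<omega>. dist_n n D (X \<omega>)) \<in> borel_measurable M"
    using X_vec by (intro lipschitz_n_measurable) (auto simp: centered_bounded_vector_def)
  have "\<P>(\<omega> in M. quad_form n A (X \<omega>) \<ge> m + s) \<le> \<P>(\<omega> in M. dist_n n D (X \<omega>) \<ge> K * (2 + sqrt p))"
  proof (rule finite_measure_mono, safe)
    fix \<omega> assume \<omega>: "\<omega> \<in> space M" and q: "m + s \<le> quad_form n A (X \<omega>)"
    show "K * (2 + sqrt p) \<le> dist_n n D (X \<omega>)"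
    proof (rule ccontr)
      assume "\<not> ?thesis"
      then obtain d where d: "d \<in> D" "L2_set (\<lambda>i. X \<omega> i - d i) {..<n} < K * (2 + sqrt p)"
        using dist_n_less[OF \<open>D \<noteq> {}\<close>, of n "X \<omega>" "K * (2 + sqrt p)"] by (auto simp: not_le)
      obtain y where y: "y \<in> test_set n p" "\<And>i. X \<omega> i = d i + scale * y i"
        by (rule displacement_in_test_set[OF p _ _ d(2)]) (use X_bounded[OF \<omega>] d(1) in \<open>auto simp: D_def\<close>)
      have "quad_form n A (X \<omega>) = quad_form n A (\<lambda>i. d i + scale * y i)"
        by (rule arg_cong[of _ _ "quad_form n A"]) (simp add: fun_eq_iff y(2))
      also have "\<dots> = quad_form n A d + 2 * scale * inner_n n (mat_vec n A d) y + scale\<^sup>2 * quad_form n A y"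
        by (simp add: quad_form_add[OF A_sym] quad_form_scale inner_n_scale_right)
      also have "\<dots> \<le> m + 2 * scale * (24 * K * N) + scale\<^sup>2 * norm_1_2 n p A"
      proof (intro add_mono mult_left_mono)
        show "inner_n n (mat_vec n A d) y \<le> 24 * K * N"
          using g(3)[OF y(1), of d] d(1) by (simp add: D_def)
        show "quad_form n A y \<le> norm_1_2 n p A"
          unfolding quad_form_def using p y(1) by (intro norm_1_2_upper n_pos) auto
      qed (use d(1) scale_pos in \<open>auto simp: D_def\<close>)
      finally show False
        using q s by (simp add: N_def mult_ac)
    qed
  qed measurable
  also have "\<dots> \<le> 2 * exp (- (sqrt p)\<^sup>2)"
    using p by (intro prob_dist_ge D prob_D) auto
  finally show ?thesis
    using p by simp
qed

text \<open>
  If the lower tail had too much mass, some \<open>X\<close> with \<open>quad_form n A X \<ge> m\<close> would be close to it;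
  since the expansion is now around \<open>X\<close>, the second-order term is nonnegative and can be dropped.
\<close>

lemma lower_tail_median:
  assumes p: "p \<ge> 1" and m: "is_median M (\<lambda>\<omega>. quad_form n A (X \<omega>)) m"
    and s: "s > 48 * K * scale * norm_12 n p A"
  shows "\<P>(\<omega> in M. quad_form n A (X \<omega>) \<le> m - s) \<le> 2 * exp (- p)"
proof (rule ccontr)
  assume contr: "\<not> ?thesis"
  note [measurable] = quad_form_measurable
  define N where "N = norm_12 n p A"
  obtain g where g: "convex_fun g" "(\<lambda>\<omega>. g (X \<omega>)) \<in> borel_measurable M"
    "\<And>x y. y \<in> test_set n p \<Longrightarrow> inner_n n (mat_vec n A x) y \<le> g x"
    "\<P>(\<omega> in M. g (X \<omega>) > 24 * K * N) \<le> 1 / 4"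
    unfolding N_def using gradient_majorant[OF p] by blast
  note [measurable] = g(2)
  define D where "D = {x. \<forall>i<n. \<bar>x i\<bar> \<le> 1} \<inter> {x. quad_form n A x \<le> m - s}"
  have D: "convex_set_n D"
    unfolding D_def
    by (intro convex_set_n_Int convex_cube convex_sublevel convex_quad_form A_sym A_psd)
  have "{\<omega> \<in> space M. X \<omega> \<in> D} = {\<omega> \<in> space M. quad_form n A (X \<omega>) \<le> m - s}"
    by (auto simp: D_def X_bounded)
  then have prob_D: "\<P>(\<omega> in M. X \<omega> \<in> D) > 2 * exp (- (sqrt p)\<^sup>2)"
    using contr p by simp
  then have "D \<noteq> {}"
    by (intro notI) (simp add: not_less)
  have "lipschitz_n n 1 (dist_n n D)"
    by (rule lipschitz_dist_n[OF \<open>D \<noteq> {}\<close>])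
  then have [measurable]: "(\<lambda>\<omega>. dist_n n D (X \<omega>)) \<in> borel_measurable M"
    using X_vec by (intro lipschitz_n_measurable) (auto simp: centered_bounded_vector_def)
  let ?far = "{\<omega> \<in> space M. dist_n n D (X \<omega>) \<ge> K * (2 + sqrt p)}"
  let ?steep = "{\<omega> \<in> space M. g (X \<omega>) > 24 * K * N}"
  \<comment> \<open>Compared with the upper tail the two parameters are exchanged: the mass of
    \<open>D\<close> now gives \<open>u = sqrt p\<close>, and the deviation is 2. The radius is the
    same.\<close>
  have "measure M ?far \<le> 2 * exp (- 2\<^sup>2)"
    using prob_dist_ge[OF D prob_D, of 2] p by (simp add: add.commute)
  then have far: "measure M ?far < 1 / 4"
    using exp_minus_four_less by simp
  have "{\<omega> \<in> space M. quad_form n A (X \<omega>) \<ge> m} \<subseteq> ?far \<union> ?steep"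
  proof (rule ccontr)
    assume "\<not> ?thesis"
    then obtain \<omega> where "\<omega> \<in> space M" "quad_form n A (X \<omega>) \<ge> m" "\<omega> \<notin> ?far \<union> ?steep"
      by blast
    then have \<omega>: "\<omega> \<in> space M" "quad_form n A (X \<omega>) \<ge> m" "g (X \<omega>) \<le> 24 * K * N"
      "dist_n n D (X \<omega>) < K * (2 + sqrt p)"
      by auto
    obtain d where d: "d \<in> D" "L2_set (\<lambda>i. X \<omega> i - d i) {..<n} < K * (2 + sqrt p)"
      using dist_n_less[OF \<open>D \<noteq> {}\<close> \<omega>(4)] by blast
    obtain y where y: "y \<in> test_set n p" "\<And>i. X \<omega> i = d i + scale * y i"
      by (rule displacement_in_test_set[OF p _ _ d(2)]) (use X_bounded[OF \<omega>(1)] d(1) in \<open>auto simp: D_def\<close>)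
    have "quad_form n A d = quad_form n A (\<lambda>i. X \<omega> i + (- scale) * y i)"
      by (rule arg_cong[of _ _ "quad_form n A"]) (simp add: fun_eq_iff y(2))
    also have "\<dots> = quad_form n A (X \<omega>) - 2 * scale * inner_n n (mat_vec n A (X \<omega>)) y
        + scale\<^sup>2 * quad_form n A y"
      unfolding quad_form_add[OF A_sym] quad_form_scale inner_n_scale_right by simp
    finally have "quad_form n A d = \<dots>" .
    moreover have "2 * scale * inner_n n (mat_vec n A (X \<omega>)) y \<le> 2 * scale * (24 * K * N)"
      using order_trans[OF g(3)[OF y(1)] \<omega>(3)] scale_pos by (intro mult_left_mono) auto
    moreover have "0 \<le> scale\<^sup>2 * quad_form n A y"
      using A_psd by (simp add: nonneg_definite_n_def quad_form_def)
    moreover have "quad_form n A d \<le> m - s"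
      using d(1) by (simp add: D_def)
    moreover have "2 * scale * (24 * K * N) = 48 * K * scale * norm_12 n p A"
      by (simp add: N_def)
    ultimately show False
      using \<omega>(2) s by linarith
  qed
  \<comment> \<open>The event on the left has probability at least 1/2, but the two covering it have
    together less than 1/4 + 1/4.\<close>
  then have "\<P>(\<omega> in M. quad_form n A (X \<omega>) \<ge> m) \<le> measure M (?far \<union> ?steep)"
    by (intro finite_measure_mono) measurable
  also have "\<dots> \<le> measure M ?far + measure M ?steep"
    by (intro measure_Un_le) measurable
  finally show False
    using far g(4) m by (simp add: is_median_def)
qed

section \<open>From the median to the mean\<close>

text \<open>The two coefficients in the threshold of \<open>upper_tail_median\<close> added up; the
  extra 1 makes the inequalities strict.\<close>

definition tail_const where "tail_const = 48 * K * scale + scale\<^sup>2 + 1"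

lemma tail_const_pos: "tail_const > 0"
  using K_pos scale_pos by (simp add: tail_const_def add_nonneg_pos)

text \<open>Both tail thresholds at parameter \<open>k \<ge> 1\<close> lie below
  \<open>b * k\<close>, with \<open>b\<close> a multiple of the Hilbert-Schmidt norm. Hence both
  tails decay exponentially at scale \<open>b\<close>, and the positive and negative parts of the
  deviation are integrated separately.\<close>

lemma mean_minus_median:
  assumes m: "is_median M (\<lambda>\<omega>. quad_form n A (X \<omega>)) m"
  shows "\<bar>expectation (\<lambda>\<omega>. quad_form n A (X \<omega>)) - m\<bar> \<le> 4 * (tail_const * hs_norm n A)"
proof -
  note [measurable] = quad_form_measurable
  define q where "q \<omega> = quad_form n A (X \<omega>)" for \<omega>
  have [measurable]: "q \<in> borel_measurable M" unfolding q_def by measurable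
  define b where "b = tail_const * hs_norm n A"
  have "b > 0" using tail_const_pos hs_norm_pos by (simp add: b_def)
  define S where "S = hs_norm n A * n + \<bar>m\<bar>"
  have qS: "q \<omega> - m \<le> S" "m - q \<omega> \<le> S" if "\<omega> \<in> space M" for \<omega>
    using quad_form_bounded[OF that] unfolding q_def S_def by linarith+
  have "S \<ge> 0" using hs_norm_pos by (simp add: S_def)
  have q_int: "integrable M q"
    using quad_form_bounded by (intro integrable_const_bound[of _ "hs_norm n A * n"]) (auto simp: q_def)
  have level: "48 * K * scale * norm_12 n k A + scale\<^sup>2 * norm_1_2 n k A < b * k" if "k \<ge> 1" for k :: real
  proof -
    have "sqrt k \<le> k"
      using that by (intro real_le_lsqrt) (auto simp: power2_eq_square)
    then have "sqrt k * hs_norm n A \<le> k * hs_norm n A"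
      using hs_norm_pos by (intro mult_right_mono) auto
    then have "norm_12 n k A \<le> k * hs_norm n A"
      using norm_12_le_hs_norm[of k] that by linarith
    then have "48 * K * scale * norm_12 n k A + scale\<^sup>2 * norm_1_2 n k A
        \<le> 48 * K * scale * (k * hs_norm n A) + scale\<^sup>2 * (k * hs_norm n A)"
      using that K_pos scale_pos norm_1_2_le[OF n_pos, of k A] by (intro add_mono mult_left_mono) auto
    also have "\<dots> < b * k"
      using that hs_norm_pos by (simp add: b_def tail_const_def algebra_simps)
    finally show ?thesis .
  qed
  have pos: "expectation (\<lambda>\<omega>. max 0 (q \<omega> - m)) \<le> 2 * 2 * b"
  proof (rule expectation_le_exponential_tail[OF _ _ _ \<open>b > 0\<close>])
    show "max 0 (q \<omega> - m) \<le> S" if "\<omega> \<in> space M" for \<omega>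
      using qS[OF that] \<open>S \<ge> 0\<close> by simp
    show "\<P>(\<omega> in M. max 0 (q \<omega> - m) \<ge> b * real k) \<le> 2 * exp (- real k)" for k :: nat
    \<comment> \<open>The tail bounds require a parameter of at least 1; at \<open>k = 0\<close> the
      bound 2 is trivial.\<close>
    proof (cases "k = 0")
      case True
      then show ?thesis by (simp add: prob_space)
    next
      case False
      then have "0 < b * real k" using \<open>b > 0\<close> by simp
      then have "(b * real k \<le> max 0 (q \<omega> - m)) = (m + b * real k \<le> q \<omega>)" for \<omega>
        by (auto simp: le_max_iff_disj)
      then show ?thesis
        using upper_tail_median[OF _ m level[of k]] False by (simp add: q_def)
    qed
  qed auto
  have neg: "expectation (\<lambda>\<omega>. max 0 (m - q \<omega>)) \<le> 2 * 2 * b"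
  proof (rule expectation_le_exponential_tail[OF _ _ _ \<open>b > 0\<close>])
    show "max 0 (m - q \<omega>) \<le> S" if "\<omega> \<in> space M" for \<omega>
      using qS[OF that] \<open>S \<ge> 0\<close> by simp
    show "\<P>(\<omega> in M. max 0 (m - q \<omega>) \<ge> b * real k) \<le> 2 * exp (- real k)" for k :: nat
    proof (cases "k = 0")
      case True
      then show ?thesis by (simp add: prob_space)
    next
      case False
      then have "0 < b * real k" using \<open>b > 0\<close> by simp
      then have "(b * real k \<le> max 0 (m - q \<omega>)) = (q \<omega> \<le> m - b * real k)" for \<omega>
        by (auto simp: le_max_iff_disj)
      moreover have "48 * K * scale * norm_12 n k A < b * real k"
      proof -
        have "0 \<le> scale\<^sup>2 * norm_1_2 n k A"
          using norm_1_2_nonneg[OF n_pos, of k A] by simp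
        then show ?thesis using level[of k] False by simp
      qed
      ultimately show ?thesis
        using lower_tail_median[OF _ m, of k "b * real k"] False by (simp add: q_def)
    qed
  qed auto
  have "expectation (\<lambda>\<omega>. q \<omega> - m) \<le> expectation (\<lambda>\<omega>. max 0 (q \<omega> - m))"
    "expectation (\<lambda>\<omega>. m - q \<omega>) \<le> expectation (\<lambda>\<omega>. max 0 (m - q \<omega>))"
    using q_int by (intro integral_mono integrable_max; simp)+
  then have "expectation q - m \<le> 4 * b" "m - expectation q \<le> 4 * b"
    using pos neg q_int by (simp_all add: prob_space)
  then show ?thesis
    unfolding b_def q_def[abs_def] by linarith
qed

text \<open>The factor 5 is 4 + 1: the passage from mean to median uses up
  \<open>4 * tail_const * norm_12 n p A\<close>, and the rest meets the threshold around the
  median.\<close>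

lemma tails_mean:
  assumes p: "p \<ge> 1"
  shows "\<P>(\<omega> in M. quad_form n A (X \<omega>) - expectation (\<lambda>\<omega>. quad_form n A (X \<omega>))
      \<ge> 5 * tail_const * (norm_12 n p A + norm_1_2 n p A)) \<le> 2 * exp (- p)" (is ?upper)
    and "\<P>(\<omega> in M. quad_form n A (X \<omega>) - expectation (\<lambda>\<omega>. quad_form n A (X \<omega>))
      \<le> - (5 * tail_const) * min (norm_12 n p A + norm_1_2 n p A) (sqrt p * hs_norm n A))
      \<le> 2 * exp (- p)" (is ?lower)
proof -
  note [measurable] = quad_form_measurable
  define q where "q \<omega> = quad_form n A (X \<omega>)" for \<omega>
  have [measurable]: "q \<in> borel_measurable M" unfolding q_def by measurable
  obtain m where m: "is_median M q m"
    using median_exists[of q] by auto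
  define N where "N = norm_12 n p A"
  define R where "R = norm_1_2 n p A"
  have "N > 0" "R \<ge> 0" and hs: "hs_norm n A \<le> N" "N \<le> sqrt p * hs_norm n A"
    using p hs_norm_le_norm_12[of p] norm_12_le_hs_norm[of p] hs_norm_pos norm_1_2_nonneg[OF n_pos, of p A]
    by (auto simp: N_def R_def)
  have "tail_const * hs_norm n A \<le> tail_const * N"
    using hs(1) tail_const_pos by (intro mult_left_mono) auto
  then have mean: "\<bar>expectation q - m\<bar> \<le> 4 * (tail_const * N)"
    using mean_minus_median[of m] m unfolding q_def[abs_def] by linarith
  have "\<P>(\<omega> in M. q \<omega> - expectation q \<ge> 5 * tail_const * (N + R)) \<le> \<P>(\<omega> in M. q \<omega> \<ge> m + tail_const * (N + R))"
  proof (rule finite_measure_mono, safe)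
    fix \<omega> assume "5 * tail_const * (N + R) \<le> q \<omega> - expectation q"
    moreover have "0 \<le> tail_const * R" using \<open>R \<ge> 0\<close> tail_const_pos by simp
    ultimately show "m + tail_const * (N + R) \<le> q \<omega>"
      using mean by (simp add: algebra_simps)
  qed measurable
  also have "\<dots> \<le> 2 * exp (- p)"
    unfolding q_def
  proof (rule upper_tail_median[OF p m[unfolded q_def[abs_def]]])
    have "0 \<le> 48 * K * scale * R" using K_pos scale_pos \<open>R \<ge> 0\<close> by simp
    moreover have "0 \<le> scale\<^sup>2 * N" using \<open>N > 0\<close> by simp
    moreover have "tail_const * (N + R)
        = 48 * K * scale * N + scale\<^sup>2 * R + 48 * K * scale * R + scale\<^sup>2 * N + N + R"
      by (simp add: tail_const_def algebra_simps)
    ultimately show "48 * K * scale * norm_12 n p A + scale\<^sup>2 * norm_1_2 n p A < tail_const * (N + R)"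
      using \<open>N > 0\<close> \<open>R \<ge> 0\<close> unfolding N_def[symmetric] R_def[symmetric] by linarith
  qed
  finally show ?upper by (simp add: q_def[abs_def] N_def R_def)
  have "\<P>(\<omega> in M. q \<omega> - expectation q \<le> - (5 * tail_const) * min (N + R) (sqrt p * hs_norm n A))
      \<le> \<P>(\<omega> in M. q \<omega> \<le> m - tail_const * N)"
  proof (rule finite_measure_mono, safe)
    fix \<omega> assume "q \<omega> - expectation q \<le> - (5 * tail_const) * min (N + R) (sqrt p * hs_norm n A)"
    \<comment> \<open>Both arguments of the minimum are at least \<open>N\<close>, so the lower tail
      needs the threshold in terms of \<open>N\<close> alone.\<close>
    moreover have "5 * tail_const * N \<le> 5 * tail_const * min (N + R) (sqrt p * hs_norm n A)"
      using \<open>R \<ge> 0\<close> hs(2) tail_const_pos by (intro mult_left_mono) auto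
    ultimately show "q \<omega> \<le> m - tail_const * N"
      using mean by linarith
  qed measurable
  also have "\<dots> \<le> 2 * exp (- p)"
    unfolding q_def
  proof (rule lower_tail_median[OF p m[unfolded q_def[abs_def]]])
    have "0 \<le> scale\<^sup>2 * N" using \<open>N > 0\<close> by simp
    moreover have "tail_const * N = 48 * K * scale * N + scale\<^sup>2 * N + N"
      by (simp add: tail_const_def algebra_simps)
    ultimately show "48 * K * scale * norm_12 n p A < tail_const * N"
      using \<open>N > 0\<close> unfolding N_def[symmetric] by linarith
  qed
  finally show ?lower by (simp add: q_def[abs_def] N_def R_def)
qed

end

section \<open>The two tail bounds with a constant depending on \<open>K\<close> only\<close>

theorem theorem5p10:
  fixes K :: real
  assumes "K > 0"
  shows "\<exists>C>0. \<forall>(n::nat) (M :: (nat \<Rightarrow> real) measure) (X :: (nat \<Rightarrow> real) \<Rightarrow> nat \<Rightarrow> real)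
      (A :: nat \<Rightarrow> nat \<Rightarrow> real) (p::real).
    n \<ge> 1 \<longrightarrow> prob_space M \<longrightarrow> centered_bounded_vector M n X \<longrightarrow>
    convex_concentration M n X K \<longrightarrow>
    symmetric_n n A \<longrightarrow> nonneg_definite_n n A \<longrightarrow> (\<exists>i<n. \<exists>j<n. A i j \<noteq> 0) \<longrightarrow> p \<ge> 0 \<longrightarrow>
    \<P>(\<omega> in M. quad_form n A (X \<omega>) - (\<integral>\<omega>'. quad_form n A (X \<omega>') \<partial>M)
        \<ge> C * (norm_12 n p A + norm_1_2 n p A)) \<le> 4 * exp (- p) \<and>
    \<P>(\<omega> in M. quad_form n A (X \<omega>) - (\<integral>\<omega>'. quad_form n A (X \<omega>') \<partial>M)
        \<le> - C * min (norm_12 n p A + norm_1_2 n p A) (sqrt p * hs_norm n A)) \<le> 4 * exp (- p)"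
proof -
  \<comment> \<open>The values of \<open>scale\<close> and \<open>tail_const\<close>, spelled out
    because the constant must be fixed before the vector and the matrix.\<close>
  define s where "s = max (3 * K) 2"
  define B where "B = 48 * K * s + s\<^sup>2 + 1"
  have "s > 0" by (simp add: s_def)
  then have "B > 0" using assms by (simp add: B_def add_nonneg_pos)
  show ?thesis
  proof (intro exI[of _ "5 * B"] conjI[of "5 * B > 0"] allI impI, goal_cases)
    case 1
    then show ?case using \<open>B > 0\<close> by simp
  next
    case (2 n M X A p)
    interpret concentrated_quadratic_form M n X K A
      using 2 assms by (simp add: concentrated_quadratic_form_def concentrated_quadratic_form_axioms_def)
    have B: "tail_const = B"
      by (simp add: tail_const_def scale_def B_def s_def)
    show ?case
    proof (cases "p \<ge> 1")
      case True
      have "2 * exp (- p) \<le> 4 * exp (- p)" by simp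
      then show ?thesis
        using tails_mean[OF True] unfolding B by (meson order_trans)
    next
      case False
      have "exp (- 1) \<le> exp (- p)" using False by simp
      \<comment> \<open>For \<open>p < 1\<close> the claimed bound exceeds
        \<open>4 * exp (- 1)\<close>, which is at least 1 since
        \<open>exp 1 \<le> 3\<close>.\<close>
      moreover have "1 \<le> 4 * exp (- 1 :: real)"
        using exp_le by (simp add: exp_minus field_simps)
      ultimately have "1 \<le> 4 * exp (- p)" by linarith
      then show ?thesis
        using prob_le_1 order_trans by blast
    qed
  qed
qed

end
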